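(* Let $X$ be a complex Banach space and $T\in\mathcal{B}(X)$. Then $\sigma_{gD\mathcal{Q}}(T)=\sigma_{gD\mathcal{W}-}(T)$ if and only if $T^*$ has SVEP at every $\lambda\notin\sigma_{gD\mathcal{W}-}(T)$.
   Context: $\mathcal{B}(X)$ is the algebra of bounded linear operators on $X$; $T^*$ is the adjoint of $T$ acting on the dual space $X^*$. $(M,N)\in Red(T)$ means that $M,N$ are closed $T$-invariant subspaces with $X=M\oplus N$. $T$ is lower semi-Fredholm if $\operatorname{codim}R(T)<\infty$, with index $ind(T)=\dim N(T)-\operatorname{codim}R(T)$ ($N(T)$, $R(T)$ being kernel and range). $T$ is generalized Drazin surjective (resp. generalized Drazin lower semi-Weyl) if there exists $(M,N)\in Red(T)$ such that $T_{|M}$ is surjective (resp. lower semi-Fredholm with index $\ge 0$) and $T_{|N}$ is quasi-nilpotent. $\sigma_{gD\mathcal{Q}}(T)$ (resp. $\sigma_{gD\mathcal{W}-}(T)$) is the set of $\lambda\in\mathbb{C}$ such that $T-\lambda I$ is not generalized Drazin surjective (resp. not generalized Drazin lower semi-Weyl). An operator $S$ on a complex Banach space $Y$ has SVEP (the single valued extension property) at $\lambda_0\in\mathbb{C}$ if for every connected open neighbourhood $U$ of $\lambda_0$ the only analytic function $f:U\to Y$ with $(S-zI)f(z)=0$ for all $z\in U$ is $f\equiv 0$. *)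

theory Defs
  imports "HOL-Analysis.Analysis" "HOL-Library.Extended_Nat" "HOL-Library.Extended_Real"
begin

section \<open>Complex Banach spaces\<close>

text \<open>
  The scalar multiplication by complex numbers extends the one by real numbers, so that the
  metric, topological and differential notions of real normed spaces can be used.
\<close>

class complex_vector = real_vector +
  fixes scaleC :: "complex \<Rightarrow> 'a \<Rightarrow> 'a" (infixr \<open>*\<^sub>C\<close> 75)
  assumes scaleC_add_right: "a *\<^sub>C (x + y) = a *\<^sub>C x + a *\<^sub>C y"
    and scaleC_add_left: "(a + b) *\<^sub>C x = a *\<^sub>C x + b *\<^sub>C x"
    and scaleC_scaleC: "a *\<^sub>C (b *\<^sub>C x) = (a * b) *\<^sub>C x"
    and scaleR_scaleC: "r *\<^sub>R x = complex_of_real r *\<^sub>C x"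

class complex_normed_vector = complex_vector + real_normed_vector +
  assumes norm_scaleC: "norm (a *\<^sub>C x) = cmod a * norm x"

class complex_banach = complex_normed_vector + banach

lemma scaleC_one: "1 *\<^sub>C x = (x :: 'a::complex_vector)"
  using scaleR_scaleC[of 1 x] by simp

global_interpretation cvs: vector_space "scaleC :: complex \<Rightarrow> 'a \<Rightarrow> 'a::complex_vector"
  by standard (simp_all add: scaleC_add_right scaleC_add_left scaleC_scaleC scaleC_one)

instantiation complex :: complex_banach
begin

definition scaleC_complex :: "complex \<Rightarrow> complex \<Rightarrow> complex"
  where "scaleC_complex a x = a * x"

instance
  by standard (simp_all add: scaleC_complex_def algebra_simps norm_mult scaleR_conv_of_real)

end

lemma bounded_linear_scaleC_right: "bounded_linear (\<lambda>x :: 'a::complex_normed_vector. a *\<^sub>C x)"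
  by (rule bounded_linear_intro[where K = "cmod a"])
    (simp_all add: scaleC_add_right scaleR_scaleC scaleC_scaleC mult.commute norm_scaleC)


section \<open>Bounded complex-linear operators\<close>

definition bounded_clinear :: "('a::complex_normed_vector \<Rightarrow> 'b::complex_normed_vector) \<Rightarrow> bool"
  where "bounded_clinear f \<longleftrightarrow> bounded_linear f \<and> (\<forall>c x. f (c *\<^sub>C x) = c *\<^sub>C f x)"

lemma bounded_clinear_linear: "bounded_clinear f \<Longrightarrow> bounded_linear f"
  by (simp add: bounded_clinear_def)

lemma bounded_clinear_scaleC: "bounded_clinear f \<Longrightarrow> f (c *\<^sub>C x) = c *\<^sub>C f x"
  by (simp add: bounded_clinear_def)

typedef (overloaded) ('a, 'b) cblinfun (\<open>(_ \<Rightarrow>\<^sub>C\<^sub>L /_)\<close> [22, 21] 21) =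
  "{f :: 'a::complex_normed_vector \<Rightarrow> 'b::complex_normed_vector. bounded_clinear f}"
  morphisms cblinfun_apply CBlinfun
  by (rule exI[of _ "\<lambda>x. 0"])
    (use cvs.scale_zero_right in \<open>auto simp: bounded_clinear_def\<close>)

declare [[coercion
    "cblinfun_apply :: ('a::complex_normed_vector \<Rightarrow>\<^sub>C\<^sub>L 'b::complex_normed_vector) \<Rightarrow> 'a \<Rightarrow> 'b"]]

setup_lifting type_definition_cblinfun

lemma bounded_clinear_cblinfun_apply: "bounded_clinear (cblinfun_apply f)"
  using cblinfun_apply[of f] by simp

lemma bounded_linear_cblinfun_apply: "bounded_linear (cblinfun_apply f)"
  using bounded_clinear_cblinfun_apply by (rule bounded_clinear_linear)

lemma cblinfun_apply_scaleC: "cblinfun_apply f (c *\<^sub>C x) = c *\<^sub>C cblinfun_apply f x"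
  using bounded_clinear_cblinfun_apply by (rule bounded_clinear_scaleC)

lemma cblinfun_eqI: "(\<And>x. cblinfun_apply f x = cblinfun_apply g x) \<Longrightarrow> f = g"
  by transfer auto

lemma onorm_scaleC:
  fixes f :: "'a::complex_normed_vector \<Rightarrow> 'b::complex_normed_vector"
  assumes "bounded_linear f"
  shows "onorm (\<lambda>x. c *\<^sub>C f x) = cmod c * onorm f"
proof -
  have le: "onorm (\<lambda>x. d *\<^sub>C g x) \<le> cmod d * onorm g"
    if "bounded_linear g" for d and g :: "'a \<Rightarrow> 'b"
  proof (rule onorm_bound)
    show "0 \<le> cmod d * onorm g"
      using that by (simp add: onorm_pos_le)
    show "norm (d *\<^sub>C g x) \<le> cmod d * onorm g * norm x" for x
      using onorm[OF that, of x] by (simp add: norm_scaleC mult.assoc mult_left_mono)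
  qed
  show ?thesis
  proof (cases "c = 0")
    case True
    then show ?thesis by (simp add: onorm_zero)
  next
    case False
    have bl: "bounded_linear (\<lambda>x. c *\<^sub>C f x)"
      by (rule bounded_linear_compose[OF bounded_linear_scaleC_right assms])
    have "onorm f = onorm (\<lambda>x. inverse c *\<^sub>C (c *\<^sub>C f x))"
      using False by (simp add: scaleC_one)
    also have "\<dots> \<le> cmod (inverse c) * onorm (\<lambda>x. c *\<^sub>C f x)"
      by (rule le[OF bl])
    finally have "cmod c * onorm f \<le> onorm (\<lambda>x. c *\<^sub>C f x)"
      using False by (simp add: norm_divide field_simps)
    then show ?thesis using le[OF assms, of c] by simp
  qed
qed

instantiation cblinfun :: (complex_normed_vector, complex_normed_vector) complex_normed_vector
begin

lift_definition norm_cblinfun :: "('a \<Rightarrow>\<^sub>C\<^sub>L 'b) \<Rightarrow> real" is onorm .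

lift_definition zero_cblinfun :: "'a \<Rightarrow>\<^sub>C\<^sub>L 'b" is "\<lambda>x. 0"
  by (simp add: bounded_clinear_def)

lift_definition plus_cblinfun :: "('a \<Rightarrow>\<^sub>C\<^sub>L 'b) \<Rightarrow> ('a \<Rightarrow>\<^sub>C\<^sub>L 'b) \<Rightarrow> ('a \<Rightarrow>\<^sub>C\<^sub>L 'b)"
  is "\<lambda>f g x. f x + g x"
  by (simp add: bounded_clinear_def bounded_linear_add scaleC_add_right)

lift_definition minus_cblinfun :: "('a \<Rightarrow>\<^sub>C\<^sub>L 'b) \<Rightarrow> ('a \<Rightarrow>\<^sub>C\<^sub>L 'b) \<Rightarrow> ('a \<Rightarrow>\<^sub>C\<^sub>L 'b)"
  is "\<lambda>f g x. f x - g x"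
  by (simp add: bounded_clinear_def bounded_linear_sub cvs.scale_right_diff_distrib)

lift_definition uminus_cblinfun :: "('a \<Rightarrow>\<^sub>C\<^sub>L 'b) \<Rightarrow> ('a \<Rightarrow>\<^sub>C\<^sub>L 'b)"
  is "\<lambda>f x. - f x"
  by (simp add: bounded_clinear_def bounded_linear_minus)

lift_definition scaleC_cblinfun :: "complex \<Rightarrow> ('a \<Rightarrow>\<^sub>C\<^sub>L 'b) \<Rightarrow> ('a \<Rightarrow>\<^sub>C\<^sub>L 'b)"
  is "\<lambda>c f x. c *\<^sub>C f x"
  by (simp add: bounded_clinear_def bounded_linear_compose[OF bounded_linear_scaleC_right]
      mult.commute)

definition scaleR_cblinfun :: "real \<Rightarrow> ('a \<Rightarrow>\<^sub>C\<^sub>L 'b) \<Rightarrow> ('a \<Rightarrow>\<^sub>C\<^sub>L 'b)"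
  where "scaleR_cblinfun r f = complex_of_real r *\<^sub>C f"

definition sgn_cblinfun :: "('a \<Rightarrow>\<^sub>C\<^sub>L 'b) \<Rightarrow> ('a \<Rightarrow>\<^sub>C\<^sub>L 'b)"
  where "sgn_cblinfun f = inverse (norm f) *\<^sub>R f"

definition dist_cblinfun :: "('a \<Rightarrow>\<^sub>C\<^sub>L 'b) \<Rightarrow> ('a \<Rightarrow>\<^sub>C\<^sub>L 'b) \<Rightarrow> real"
  where "dist_cblinfun f g = norm (f - g)"

definition uniformity_cblinfun :: "(('a \<Rightarrow>\<^sub>C\<^sub>L 'b) \<times> ('a \<Rightarrow>\<^sub>C\<^sub>L 'b)) filter"
  where "uniformity_cblinfun = (INF e\<in>{0 <..}. principal {(f, g). dist f g < e})"

definition open_cblinfun :: "('a \<Rightarrow>\<^sub>C\<^sub>L 'b) set \<Rightarrow> bool"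
  where "open_cblinfun S = (\<forall>f\<in>S. \<forall>\<^sub>F (f', g) in uniformity. f' = f \<longrightarrow> g \<in> S)"

instance
proof
  fix f g h :: "'a \<Rightarrow>\<^sub>C\<^sub>L 'b" and a b :: complex and r s :: real
  show "f + g + h = f + (g + h)" "f + g = g + f" "0 + f = f" "- f + f = 0" "f - g = f + - g"
    by (transfer; simp add: algebra_simps)+
  show aC: "a *\<^sub>C (f + g) = a *\<^sub>C f + a *\<^sub>C g" for a and f g :: "'a \<Rightarrow>\<^sub>C\<^sub>L 'b"
    by transfer (simp add: scaleC_add_right)
  show bC: "(a + b) *\<^sub>C f = a *\<^sub>C f + b *\<^sub>C f" for a b
    by transfer (simp add: scaleC_add_left)
  show cC: "a *\<^sub>C (b *\<^sub>C f) = (a * b) *\<^sub>C f" for a b and f :: "'a \<Rightarrow>\<^sub>C\<^sub>L 'b"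
    by transfer (simp add: scaleC_scaleC)
  have oneC: "1 *\<^sub>C f = f"
    by transfer (simp add: scaleC_one)
  show "r *\<^sub>R f = complex_of_real r *\<^sub>C f"
    by (rule scaleR_cblinfun_def)
  show "r *\<^sub>R (f + g) = r *\<^sub>R f + r *\<^sub>R g" "(r + s) *\<^sub>R f = r *\<^sub>R f + s *\<^sub>R f"
    "r *\<^sub>R (s *\<^sub>R f) = (r * s) *\<^sub>R f" "1 *\<^sub>R f = f"
    by (simp_all add: scaleR_cblinfun_def aC bC cC oneC)
  show nC: "norm (a *\<^sub>C f) = cmod a * norm f" for a
    by transfer (simp add: onorm_scaleC bounded_clinear_linear)
  show "norm (r *\<^sub>R f) = \<bar>r\<bar> * norm f"
    by (simp add: scaleR_cblinfun_def nC)
  show "(norm f = 0) = (f = 0)"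
    by transfer (auto simp: onorm_eq_0 bounded_clinear_linear)
  show "norm (f + g) \<le> norm f + norm g"
    by transfer (simp add: onorm_triangle bounded_clinear_linear)
  show "sgn f = inverse (norm f) *\<^sub>R f"
    by (rule sgn_cblinfun_def)
  show "dist f g = norm (f - g)"
    by (rule dist_cblinfun_def)
  show "(uniformity :: (('a \<Rightarrow>\<^sub>C\<^sub>L 'b) \<times> ('a \<Rightarrow>\<^sub>C\<^sub>L 'b)) filter)
      = (INF e\<in>{0 <..}. principal {(f, g). dist f g < e})"
    by (rule uniformity_cblinfun_def)
  show "open S = (\<forall>f\<in>S. \<forall>\<^sub>F (f', g) in uniformity. f' = f \<longrightarrow> g \<in> S)"
    for S :: "('a \<Rightarrow>\<^sub>C\<^sub>L 'b) set"
    by (rule open_cblinfun_def)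
qed

end

lemma norm_cblinfun: "norm (cblinfun_apply f x) \<le> norm f * norm x"
  by transfer (simp add: onorm bounded_clinear_linear)

lemma norm_cblinfun_bound:
  "0 \<le> b \<Longrightarrow> (\<And>x. norm (cblinfun_apply f x) \<le> b * norm x) \<Longrightarrow> norm f \<le> b"
  by transfer (rule onorm_bound)

instance cblinfun :: (complex_normed_vector, complex_banach) complex_banach
proof
  fix X :: "nat \<Rightarrow> 'a \<Rightarrow>\<^sub>C\<^sub>L 'b"
  assume X: "Cauchy X"
  define Y where "Y n = Blinfun (cblinfun_apply (X n))" for n
  have Y: "blinfun_apply (Y n) = cblinfun_apply (X n)" for n
    by (simp add: Y_def bounded_linear_Blinfun_apply bounded_linear_cblinfun_apply)
  have "norm (Y m - Y n) = norm (X m - X n)" for m n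
    by (simp add: norm_blinfun.rep_eq norm_cblinfun.rep_eq minus_blinfun.rep_eq
        minus_cblinfun.rep_eq Y)
  then have "Cauchy Y"
    using X by (simp add: Cauchy_def dist_norm)
  then obtain L where L: "Y \<longlonglongrightarrow> L"
    by (auto simp: Cauchy_convergent_iff convergent_def)
  have lim: "(\<lambda>n. cblinfun_apply (X n) x) \<longlonglongrightarrow> blinfun_apply L x" for x
    using blinfun.tendsto[OF L tendsto_const[of x]] by (simp add: Y)
  have "blinfun_apply L (c *\<^sub>C x) = c *\<^sub>C blinfun_apply L x" for c x
    using lim[of "c *\<^sub>C x"] bounded_linear.tendsto[OF bounded_linear_scaleC_right[of c] lim[of x]]
    by (simp add: cblinfun_apply_scaleC LIMSEQ_unique)
  then have "bounded_clinear (blinfun_apply L)"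
    by (simp add: bounded_clinear_def blinfun.bounded_linear_right)
  then have Z: "cblinfun_apply (CBlinfun (blinfun_apply L)) = blinfun_apply L"
    by (simp add: CBlinfun_inverse)
  have "norm (Y n - L) = norm (X n - CBlinfun (blinfun_apply L))" for n
    by (simp add: norm_blinfun.rep_eq norm_cblinfun.rep_eq minus_blinfun.rep_eq
        minus_cblinfun.rep_eq Y Z)
  then have "X \<longlonglongrightarrow> CBlinfun (blinfun_apply L)"
    using L by (simp add: LIMSEQ_iff)
  then show "convergent X"
    by (auto simp: convergent_def)
qed

lift_definition id_cblinfun :: "'a::complex_normed_vector \<Rightarrow>\<^sub>C\<^sub>L 'a" is "\<lambda>x. x"
  by (simp add: bounded_clinear_def)

lift_definition cblinfun_compose ::
  "('b::complex_normed_vector \<Rightarrow>\<^sub>C\<^sub>L 'c::complex_normed_vector)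
    \<Rightarrow> ('a::complex_normed_vector \<Rightarrow>\<^sub>C\<^sub>L 'b) \<Rightarrow> ('a \<Rightarrow>\<^sub>C\<^sub>L 'c)" (infixl \<open>o\<^sub>C\<^sub>L\<close> 67)
  is "\<lambda>f g x. f (g x)"
  by (simp add: bounded_clinear_def bounded_linear_compose)

lemma norm_cblinfun_compose: "norm (f o\<^sub>C\<^sub>L g) \<le> norm f * norm g"
  by transfer (use onorm_compose in \<open>force simp: bounded_clinear_def o_def\<close>)

type_synonym 'a cdual = "'a \<Rightarrow>\<^sub>C\<^sub>L complex"

text \<open>The Banach space adjoint; it depends linearly on the operator.\<close>

lift_definition cadjoint :: "('a::complex_normed_vector \<Rightarrow>\<^sub>C\<^sub>L 'a) \<Rightarrow> ('a cdual \<Rightarrow>\<^sub>C\<^sub>L 'a cdual)"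
  is "\<lambda>T \<phi>. \<phi> o\<^sub>C\<^sub>L T"
proof -
  fix T :: "'a \<Rightarrow>\<^sub>C\<^sub>L 'a"
  have "bounded_linear (\<lambda>\<phi> :: 'a cdual. \<phi> o\<^sub>C\<^sub>L T)"
  proof (rule bounded_linear_intro[where K = "norm T"])
    fix \<phi> \<psi> :: "'a cdual" and r :: real
    show "(\<phi> + \<psi>) o\<^sub>C\<^sub>L T = \<phi> o\<^sub>C\<^sub>L T + \<psi> o\<^sub>C\<^sub>L T"
      by transfer simp
    show "(r *\<^sub>R \<phi>) o\<^sub>C\<^sub>L T = r *\<^sub>R (\<phi> o\<^sub>C\<^sub>L T)"
      unfolding scaleR_cblinfun_def by transfer simp
    show "norm (\<phi> o\<^sub>C\<^sub>L T) \<le> norm \<phi> * norm T"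
      by (rule norm_cblinfun_compose)
  qed
  moreover have "(c *\<^sub>C \<phi>) o\<^sub>C\<^sub>L T = c *\<^sub>C (\<phi> o\<^sub>C\<^sub>L T)" for c and \<phi> :: "'a cdual"
    by transfer simp
  ultimately show "bounded_clinear (\<lambda>\<phi> :: 'a cdual. \<phi> o\<^sub>C\<^sub>L T)"
    by (simp add: bounded_clinear_def)
qed


section \<open>Dimension and codimension\<close>

text \<open>
  The library's \<open>cvs.dim\<close> is \<open>0\<close> for infinite-dimensional spaces, hence the case distinction.
\<close>

definition edim :: "'a::complex_vector set \<Rightarrow> enat"
  where "edim V = (if \<exists>B. finite B \<and> V = cvs.span B then enat (cvs.dim V) else \<infinity>)"

text \<open>
  The dimension of the quotient of the subspace \<open>M\<close> by its subspace \<open>R\<close>: the least number of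
  vectors of \<open>M\<close> whose cosets span \<open>M / R\<close>, and \<open>\<infinity>\<close> (the infimum of the empty set) if no
  finite number does.
\<close>

definition ecodim :: "'a::complex_vector set \<Rightarrow> 'a set \<Rightarrow> enat"
  where "ecodim M R = (INF B \<in> {B. finite B \<and> B \<subseteq> M \<and> M \<subseteq> cvs.span (R \<union> B)}. enat (card B))"

lemma ecodim_eq_edim_complement:
  fixes R C :: "'a::complex_vector set"
  assumes R: "cvs.subspace R" and C: "cvs.subspace C" and RC: "R \<inter> C = {0}"
    and M: "M = {r + c | r c. r \<in> R \<and> c \<in> C}"
  shows "ecodim M R = edim C"
proof (rule antisym)
  show "ecodim M R \<le> edim C"
  proof (cases "\<exists>B. finite B \<and> C = cvs.span B")
    case True
    then obtain B0 where B0: "finite B0" "C = cvs.span B0" by auto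
    obtain B where B: "B \<subseteq> C" "cvs.independent B" "C \<subseteq> cvs.span B" "card B = cvs.dim C"
      by (rule cvs.basis_exists)
    have "finite B"
      using cvs.independent_span_bound[OF B0(1) B(2)] B(1) B0(2) by auto
    moreover have "B \<subseteq> M"
      using B(1) cvs.subspace_0[OF R] by (force simp: M)
    moreover have "M \<subseteq> cvs.span (R \<union> B)"
      using B(3) by (auto simp: M cvs.span_Un intro: cvs.span_base)
    ultimately have "ecodim M R \<le> enat (card B)"
      unfolding ecodim_def by (intro INF_lower) auto
    then show ?thesis
      using True B(4) by (simp add: edim_def)
  next
    case False
    then have "edim C = \<infinity>" unfolding edim_def by (rule if_not_P)
    then show ?thesis by simp
  qed
  show "edim C \<le> ecodim M R"
    unfolding ecodim_def
  proof (rule INF_greatest, clarify)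
    fix B assume B: "finite B" "B \<subseteq> M" "M \<subseteq> cvs.span (R \<union> B)"
    have "\<forall>b\<in>B. \<exists>c. c \<in> C \<and> b - c \<in> R"
      using B(2) by (force simp: M)
    then obtain p where p: "\<And>b. b \<in> B \<Longrightarrow> p b \<in> C \<and> b - p b \<in> R"
      by metis
    have pC: "cvs.span (p ` B) \<subseteq> C"
      using p by (intro cvs.span_minimal C) auto
    have "C \<subseteq> cvs.span (p ` B)"
    proof
      fix c assume c: "c \<in> C"
      have "R \<union> B \<subseteq> {x + y | x y. x \<in> R \<and> y \<in> cvs.span (p ` B)}"
      proof
        fix x assume "x \<in> R \<union> B"
        then show "x \<in> {x + y | x y. x \<in> R \<and> y \<in> cvs.span (p ` B)}"
        proof
          assume "x \<in> R"
          then show ?thesis using cvs.span_zero[of "p ` B"] by force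
        next
          assume "x \<in> B"
          moreover have "x = (x - p x) + p x" by simp
          ultimately show ?thesis using p[of x] cvs.span_base[of "p x" "p ` B"] by blast
        qed
      qed
      then have "cvs.span (R \<union> B) \<subseteq> {x + y | x y. x \<in> R \<and> y \<in> cvs.span (p ` B)}"
        by (rule cvs.span_minimal) (intro cvs.subspace_sums R cvs.subspace_span)
      moreover have "c \<in> M"
        using c cvs.subspace_0[OF R] by (force simp: M)
      ultimately obtain r s where rs: "c = r + s" "r \<in> R" "s \<in> cvs.span (p ` B)"
        using B(3) by blast
      then have "r \<in> C"
        using c pC cvs.subspace_diff[OF C, of c s] by auto
      then have "r = 0" using rs(2) RC by auto
      then show "c \<in> cvs.span (p ` B)" using rs by simp
    qed
    then have C_eq: "C = cvs.span (p ` B)" and "cvs.dim C \<le> card (p ` B)"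
      using pC B(1) by (blast, intro cvs.dim_le_card) auto
    then have "cvs.dim C \<le> card B"
      using card_image_le[OF B(1), of p] by simp
    moreover have "edim C = enat (cvs.dim C)"
      unfolding edim_def using C_eq B(1) by (intro if_P) blast
    ultimately show "edim C \<le> enat (card B)" by simp
  qed
qed


section \<open>Restrictions to invariant subspaces\<close>

definition closed_csubspace :: "'a::complex_normed_vector set \<Rightarrow> bool"
  where "closed_csubspace M \<longleftrightarrow> cvs.subspace M \<and> closed M"

definition Red :: "('a::complex_normed_vector \<Rightarrow>\<^sub>C\<^sub>L 'a) \<Rightarrow> ('a set \<times> 'a set) set"
  where "Red T = {(M, N). closed_csubspace M \<and> closed_csubspace N \<and> T ` M \<subseteq> M \<and> T ` N \<subseteq> N
    \<and> M \<inter> N = {0} \<and> {m + n | m n. m \<in> M \<and> n \<in> N} = UNIV}"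

text \<open>
  The predicates below speak about the restriction of an operator \<open>T\<close> to a closed
  \<open>T\<close>-invariant subspace, regarded as an operator on that subspace.
\<close>

definition surjective_on :: "'a::complex_normed_vector set \<Rightarrow> ('a \<Rightarrow>\<^sub>C\<^sub>L 'a) \<Rightarrow> bool"
  where "surjective_on M T \<longleftrightarrow> T ` M = M"

definition kernel_on :: "'a::complex_normed_vector set \<Rightarrow> ('a \<Rightarrow>\<^sub>C\<^sub>L 'a) \<Rightarrow> 'a set"
  where "kernel_on M T = {x \<in> M. T x = 0}"

definition lower_semi_Fredholm_on :: "'a::complex_normed_vector set \<Rightarrow> ('a \<Rightarrow>\<^sub>C\<^sub>L 'a) \<Rightarrow> bool"
  where "lower_semi_Fredholm_on M T \<longleftrightarrow> ecodim M (T ` M) < \<infinity>"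

text \<open>Only meaningful for lower semi-Fredholm restrictions, where it lies in \<open>\<int> \<union> {\<infinity>}\<close>.\<close>

definition index_on :: "'a::complex_normed_vector set \<Rightarrow> ('a \<Rightarrow>\<^sub>C\<^sub>L 'a) \<Rightarrow> ereal"
  where "index_on M T = ereal_of_enat (edim (kernel_on M T)) - ereal_of_enat (ecodim M (T ` M))"

text \<open>
  Invertibility in the algebra of bounded operators on \<open>N\<close>: the last conjunct says that the
  (automatically linear) inverse is bounded.
\<close>

definition invertible_on :: "'a::complex_normed_vector set \<Rightarrow> ('a \<Rightarrow>\<^sub>C\<^sub>L 'a) \<Rightarrow> bool"
  where "invertible_on N T \<longleftrightarrow> bij_betw T N N \<and> (\<exists>K. \<forall>x\<in>N. norm x \<le> K * norm (T x))"

definition spectrum_on :: "'a::complex_normed_vector set \<Rightarrow> ('a \<Rightarrow>\<^sub>C\<^sub>L 'a) \<Rightarrow> complex set"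
  where "spectrum_on N T = {\<mu>. \<not> invertible_on N (T - \<mu> *\<^sub>C id_cblinfun)}"

text \<open>Inclusion instead of equality: the operator on \<open>N = {0}\<close> has empty spectrum.\<close>

definition quasinilpotent_on :: "'a::complex_normed_vector set \<Rightarrow> ('a \<Rightarrow>\<^sub>C\<^sub>L 'a) \<Rightarrow> bool"
  where "quasinilpotent_on N T \<longleftrightarrow> spectrum_on N T \<subseteq> {0}"


section \<open>Generalized Drazin spectra and the single valued extension property\<close>

definition gD_surjective :: "('a::complex_banach \<Rightarrow>\<^sub>C\<^sub>L 'a) \<Rightarrow> bool"
  where "gD_surjective T \<longleftrightarrow>
    (\<exists>(M, N) \<in> Red T. surjective_on M T \<and> quasinilpotent_on N T)"

definition gD_lower_semi_Weyl :: "('a::complex_banach \<Rightarrow>\<^sub>C\<^sub>L 'a) \<Rightarrow> bool"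
  where "gD_lower_semi_Weyl T \<longleftrightarrow>
    (\<exists>(M, N) \<in> Red T. lower_semi_Fredholm_on M T \<and> index_on M T \<ge> 0 \<and> quasinilpotent_on N T)"

definition sigma_gDQ :: "('a::complex_banach \<Rightarrow>\<^sub>C\<^sub>L 'a) \<Rightarrow> complex set"
  where "sigma_gDQ T = {\<mu>. \<not> gD_surjective (T - \<mu> *\<^sub>C id_cblinfun)}"

definition sigma_gDW_minus :: "('a::complex_banach \<Rightarrow>\<^sub>C\<^sub>L 'a) \<Rightarrow> complex set"
  where "sigma_gDW_minus T = {\<mu>. \<not> gD_lower_semi_Weyl (T - \<mu> *\<^sub>C id_cblinfun)}"

text \<open>Analytic vector-valued functions on an open set: complex differentiable at every point.\<close>

definition canalytic_on :: "(complex \<Rightarrow> 'a::complex_banach) \<Rightarrow> complex set \<Rightarrow> bool"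
  where "canalytic_on f U \<longleftrightarrow> (\<forall>z\<in>U. \<exists>D. (f has_derivative (\<lambda>h. h *\<^sub>C D)) (at z))"

definition SVEP_at :: "('a::complex_banach \<Rightarrow>\<^sub>C\<^sub>L 'a) \<Rightarrow> complex \<Rightarrow> bool"
  where "SVEP_at S \<mu> \<longleftrightarrow>
    (\<forall>U. open U \<and> connected U \<and> \<mu> \<in> U \<longrightarrow>
      (\<forall>f. canalytic_on f U \<and> (\<forall>z\<in>U. (S - z *\<^sub>C id_cblinfun) (f z) = 0)
        \<longrightarrow> (\<forall>z\<in>U. f z = 0)))"

end

theory Submission
  imports Defs "HOL-Complex_Analysis.Conformal_Mappings"
begin

text \<open>
  Surjectivity is lower semi-Fredholmness with codimension \<open>0\<close>, so \<open>sigma_gDW_minus T\<close> is always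
  contained in \<open>sigma_gDQ T\<close>, and the two spectra agree iff at every \<open>\<mu>\<close> outside the smaller one
  \<open>S = T - \<mu>\<close> is generalized Drazin surjective. So it suffices to show, for a decomposition
  \<open>X = M \<oplus> N\<close> with \<open>S\<close> lower semi-Fredholm on \<open>M\<close> and quasi-nilpotent on \<open>N\<close>, that the SVEP of the
  adjoint at \<open>\<mu>\<close> makes \<open>S\<close> generalized Drazin surjective, and that conversely generalized Drazin
  surjectivity of \<open>S\<close> gives the SVEP of the adjoint at \<open>\<mu>\<close>.

  From surjectivity to SVEP (\<open>adjoint_SVEP_of_gD_surjective\<close>): an eigenvector \<open>f z\<close> of the adjoint
  is a functional with \<open>f z \<circ> S = (z - \<mu>) f z\<close>. By the open mapping theorem vectors of \<open>M\<close> have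
  preimages in \<open>M\<close> of comparable size, so \<open>f z\<close> vanishes on \<open>M\<close> as soon as \<open>\<bar>z - \<mu>\<bar>\<close> is small; it
  vanishes on \<open>N\<close> for \<open>z \<noteq> \<mu>\<close>, because \<open>S - (z - \<mu>)\<close> maps \<open>N\<close> onto itself. Hence \<open>f = 0\<close> on a
  punctured neighbourhood of \<open>\<mu>\<close>, and everywhere by the identity theorem.

  From SVEP to surjectivity (\<open>gD_surjective_of_adjoint_SVEP\<close>): the main point is that \<open>S\<close> has finite
  descent on \<open>M\<close> (\<open>finite_descent_of_adjoint_SVEP\<close>). The subspaces \<open>S M + ker (S^n)\<close> increase and
  have finite codimension, so they stabilise; this says that for some \<open>p\<close> the kernel of \<open>S\<close> on
  \<open>L = S^p M\<close> lies in all the ranges \<open>S^n L\<close>. If \<open>S L \<noteq> L\<close>, take a bounded functional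
  \<open>\<phi> 0 \<noteq> 0\<close> on \<open>L\<close> that kills \<open>S L\<close>. The kernel condition makes it possible to solve
  \<open>\<phi> (n + 1) \<circ> S = \<phi> n\<close> successively with geometric growth of the norms
  (\<open>functionals_pulled_back_along_operator\<close>). Composing with \<open>S^p\<close> and with the projection onto \<open>M\<close>
  yields functionals on \<open>X\<close> that are the coefficients of a power series in \<open>z - \<mu>\<close> solving the
  eigenvector equation of the adjoint, and its value at \<open>\<mu>\<close> is not \<open>0\<close>. This contradicts SVEP.

  So \<open>S L = L\<close>. Such an \<open>L\<close> splits off: it has a finite-dimensional \<open>S\<close>-invariant complement \<open>F\<close> in
  \<open>M\<close> (\<open>invariant_complement\<close>), on which \<open>S^p = 0\<close>. Then \<open>X = L \<oplus> (F \<oplus> N)\<close> is the desired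
  decomposition. The closedness of ranges of finite codimension and the choices of preimages with
  control of the norm come from the open mapping theorem.
\<close>

section \<open>The open mapping theorem for closed subspaces\<close>

text \<open>
  The Baire half of the open mapping theorem: one of the closures of the images of balls of integer
  radius has interior points in \<open>W\<close>, and differences of its points fill a ball around \<open>0\<close>.
\<close>

lemma approximate_preimages:
  fixes G :: "'c::banach \<Rightarrow> 'd::banach"
  assumes G: "bounded_linear G" and V: "subspace V" and W: "subspace W" "closed W"
    and GV: "G ` V = W"
  shows "\<exists>C>0. \<forall>y\<in>W. \<exists>x\<in>V. norm x \<le> C * norm y \<and> norm (y - G x) \<le> norm y / 2"
proof -
  interpret G: bounded_linear G by (rule G)
  define A where "A n = closure (G ` (V \<inter> ball 0 (real n)))" for n :: nat
  have AW: "A n \<subseteq> W" for n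
    unfolding A_def using GV by (intro closure_minimal W) auto
  have WA: "\<Union>(range A) = W"
  proof
    show "\<Union>(range A) \<subseteq> W" using AW by auto
    show "W \<subseteq> \<Union>(range A)"
    proof
      fix y assume "y \<in> W"
      then obtain x where x: "x \<in> V" "y = G x" using GV by auto
      obtain n :: nat where "norm x < real n" using reals_Archimedean2 by blast
      then have "y \<in> A n"
        unfolding A_def using x by (intro subsetD[OF closure_subset]) auto
      then show "y \<in> \<Union>(range A)" by auto
    qed
  qed
  have "\<exists>n. top_of_set W interior_of A n \<noteq> {}"
  proof (rule ccontr)
    assume "\<not> ?thesis"
    then have "top_of_set W interior_of \<Union>(range A) = {}"
    proof (intro Baire_category_alt)
      show "completely_metrizable_space (top_of_set W)
          \<or> locally_compact_space (top_of_set W) \<and> regular_space (top_of_set W)"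
        using W(2) by (simp add: completely_metrizable_space_closedin completely_metrizable_space_euclidean)
    next
      fix S assume "\<not> (\<exists>n. top_of_set W interior_of A n \<noteq> {})" "S \<in> range A"
      then show "closedin (top_of_set W) S \<and> top_of_set W interior_of S = {}"
        using AW by (auto simp: A_def closed_subset)
    qed auto
    moreover have "top_of_set W interior_of W = W"
      by (metis interior_of_topspace topspace_euclidean_subtopology)
    ultimately show False
      using WA subspace_0[OF W(1)] by auto
  qed
  then obtain n w0 where "w0 \<in> top_of_set W interior_of A n" by auto
  then obtain U where U: "openin (top_of_set W) U" "w0 \<in> U" "U \<subseteq> A n"
    by (auto simp: interior_of_def)
  then obtain e where e: "e > 0" "ball w0 e \<inter> W \<subseteq> A n"
    by (meson openin_contains_ball subset_trans)
  have w0: "w0 \<in> W" "w0 \<in> A n" using U AW by auto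
  have A_near: "\<exists>x\<in>V. norm x < real n \<and> dist (G x) a < d" if a: "a \<in> A n" "d > 0" for a d
  proof -
    obtain b where "b \<in> G ` (V \<inter> ball 0 (real n))" "dist b a < d"
      using a(1)[unfolded A_def closure_approachable, rule_format, OF a(2)] ..
    then show ?thesis by auto
  qed
  have near: "\<exists>x\<in>V. norm x \<le> 2 * real n \<and> norm (y - G x) < d"
    if y: "y \<in> W" "norm y < e" and d: "d > 0" for y d
  proof -
    have "w0 + y \<in> A n"
      using e y w0 W(1) by (auto simp: dist_norm subspace_add)
    then obtain x1 where x1: "x1 \<in> V" "norm x1 < real n" "dist (G x1) (w0 + y) < d / 2"
      using A_near[of "w0 + y" "d / 2"] d by auto
    obtain x2 where x2: "x2 \<in> V" "norm x2 < real n" "dist (G x2) w0 < d / 2"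
      using A_near[of w0 "d / 2"] d w0(2) by auto
    have "norm (y - G (x1 - x2)) = norm ((G x2 - w0) - (G x1 - (w0 + y)))"
      by (simp add: G.diff algebra_simps)
    also have "\<dots> \<le> dist (G x2) w0 + dist (G x1) (w0 + y)"
      unfolding dist_norm by (rule norm_triangle_ineq4)
    also have "\<dots> < d" using x1 x2 by simp
    finally have "norm (y - G (x1 - x2)) < d" .
    moreover have "norm (x1 - x2) \<le> 2 * real n"
      using norm_triangle_ineq4[of x1 x2] x1 x2 by simp
    ultimately show ?thesis using subspace_diff[OF V x1(1) x2(1)] by blast
  qed
  \<comment> \<open>The summand \<open>1\<close> keeps the constant positive in the case \<open>n = 0\<close>.\<close>
  define C where "C = 4 * real n / e + 1"
  have "C > 0" using e by (simp add: C_def add_nonneg_pos)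
  moreover have "\<exists>x\<in>V. norm x \<le> C * norm y \<and> norm (y - G x) \<le> norm y / 2" if y: "y \<in> W" for y
  proof (cases "y = 0")
    case True
    then show ?thesis using subspace_0[OF V] by (intro bexI[of _ 0]) (auto simp: G.zero)
  next
    case False
    \<comment> \<open>Scales \<open>y\<close> into the ball of radius \<open>e\<close>, where approximate preimages are known.\<close>
    define t where "t = e / (2 * norm y)"
    have t: "t > 0" using e False by (simp add: t_def)
    have "norm (t *\<^sub>R y) < e" using e False by (simp add: t_def)
    then obtain x where x: "x \<in> V" "norm x \<le> 2 * real n" "norm (t *\<^sub>R y - G x) < t * (norm y / 2)"
      using near[of "t *\<^sub>R y" "t * (norm y / 2)"] y t False subspace_scale[OF W(1)] by auto
    define u where "u = inverse t *\<^sub>R x"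
    have "u \<in> V" using x subspace_scale[OF V] by (simp add: u_def)
    moreover have "norm u \<le> C * norm y"
    proof -
      have "norm u = norm x / t" using t by (simp add: u_def divide_inverse)
      also have "\<dots> \<le> 2 * real n / t" using x t by (simp add: divide_right_mono)
      also have "\<dots> = 4 * real n / e * norm y" using e False by (simp add: t_def field_simps)
      also have "\<dots> \<le> C * norm y" by (simp add: C_def distrib_right)
      finally show ?thesis .
    qed
    moreover have "norm (y - G u) \<le> norm y / 2"
    proof -
      have "y - G u = inverse t *\<^sub>R (t *\<^sub>R y - G x)"
        using t by (simp add: u_def G.scaleR scaleR_right_diff_distrib)
      then have "norm (y - G u) = norm (t *\<^sub>R y - G x) / t"
        using t by (simp add: divide_inverse)
      also have "\<dots> \<le> norm y / 2" using x(3) t by (simp add: field_simps)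
      finally show ?thesis .
    qed
    ultimately show ?thesis by blast
  qed
  ultimately show ?thesis by blast
qed

text \<open>
  The remaining error of an approximate preimage is halved at each step, so correcting it again and
  again gives a geometrically convergent series of vectors whose sum is an exact preimage.
\<close>

lemma open_mapping_subspaces:
  fixes G :: "'c::banach \<Rightarrow> 'd::banach"
  assumes G: "bounded_linear G" and V: "subspace V" "closed V" and W: "subspace W" "closed W"
    and GV: "G ` V = W"
  obtains C where "C > 0" "\<And>y. y \<in> W \<Longrightarrow> \<exists>x\<in>V. G x = y \<and> norm x \<le> C * norm y"
proof -
  interpret G: bounded_linear G by (rule G)
  obtain C s where C: "C > 0"
    and s: "\<And>y. y \<in> W \<Longrightarrow> s y \<in> V \<and> norm (s y) \<le> C * norm y \<and> norm (y - G (s y)) \<le> norm y / 2"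
    using approximate_preimages[OF G V(1) W GV] by metis
  have "\<exists>x\<in>V. G x = y \<and> norm x \<le> (2 * C) * norm y" if y: "y \<in> W" for y
  proof -
    \<comment> \<open>The error that remains after \<open>k\<close> corrections.\<close>
    define r where "r k = ((\<lambda>y. y - G (s y)) ^^ k) y" for k
    have r0: "r 0 = y" and rS: "r (Suc k) = r k - G (s (r k))" for k
      by (simp_all add: r_def)
    have rW: "r k \<in> W" and rn: "norm (r k) \<le> norm y * (1/2) ^ k" for k
    proof (induction k)
      case 0 show "r 0 \<in> W" "norm (r 0) \<le> norm y * (1/2) ^ 0" using y by (simp_all add: r0)
    next
      case (Suc k)
      have "G (s (r k)) \<in> W" using s[OF Suc(1)] GV by auto
      then show "r (Suc k) \<in> W" using subspace_diff[OF W(1) Suc(1)] by (simp add: rS)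
      show "norm (r (Suc k)) \<le> norm y * (1/2) ^ Suc k" using s[OF Suc(1)] Suc(2) by (simp add: rS)
    qed
    have sn: "norm (s (r k)) \<le> C * norm y * (1/2) ^ k" for k
      using s[OF rW[of k]] rn[of k] C by (smt (verit) mult.assoc mult_left_mono)
    have gs: "(\<lambda>k. C * norm y * (1/2) ^ k) sums (C * norm y * 2)"
      using geometric_sums[of "1/2::real"] by (intro sums_mult) simp
    have summ: "summable (\<lambda>k. norm (s (r k)))"
      by (rule summable_comparison_test'[OF sums_summable[OF gs], where N = 0]) (use sn in simp)
    define x where "x = (\<Sum>k. s (r k))"
    have sx: "(\<lambda>k. s (r k)) sums x"
      unfolding x_def by (rule summable_sums[OF summable_norm_cancel[OF summ]])
    have "(\<Sum>k<n. s (r k)) \<in> V" for n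
      using s rW by (intro subspace_sum[OF V(1)]) auto
    then have "x \<in> V"
      using closed_sequentially[OF V(2) _ sx[unfolded sums_def]] by blast
    moreover have "norm x \<le> 2 * C * norm y"
    proof -
      have "norm x \<le> (\<Sum>k. norm (s (r k)))" unfolding x_def by (rule summable_norm[OF summ])
      also have "\<dots> \<le> C * norm y * 2"
        using suminf_le[OF sn summ sums_summable[OF gs]] sums_unique[OF gs] by simp
      finally show ?thesis by simp
    qed
    moreover have "G x = y"
    proof -
      have part: "(\<Sum>k<n. G (s (r k))) = y - r n" for n
        by (induction n) (simp_all add: r0 rS)
      have "(\<lambda>n. norm y * (1/2) ^ n) \<longlonglongrightarrow> norm y * 0"
        by (intro tendsto_mult tendsto_const LIMSEQ_power_zero) simp
      then have "r \<longlonglongrightarrow> 0"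
        using Lim_null_comparison[of r "\<lambda>n. norm y * (1/2) ^ n" sequentially] rn by simp
      then have "(\<lambda>n. y - r n) \<longlonglongrightarrow> y - 0" by (intro tendsto_intros)
      then have "(\<lambda>k. G (s (r k))) sums y" unfolding sums_def part by simp
      then show ?thesis using G.sums[OF sx] sums_unique2 by blast
    qed
    ultimately show ?thesis by blast
  qed
  then show ?thesis using C by (intro that[of "2 * C"]) auto
qed

section \<open>Subspaces of finite codimension\<close>

lemma subspace_of_csubspace: "cvs.subspace V \<Longrightarrow> subspace V"
  by (simp add: cvs.subspace_def subspace_def scaleR_scaleC)

lemma closed_csubspaceD: "closed_csubspace M \<Longrightarrow> cvs.subspace M \<and> closed M \<and> subspace M"
  by (simp add: closed_csubspace_def subspace_of_csubspace)

text \<open>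
  Steinitz exchange relative to a set \<open>V\<close>: a vector outside the span of \<open>V\<close> can replace one of the
  vectors needed in addition to \<open>V\<close>. Enlarging a subspace of finite codimension thus lowers the
  number of additional vectors, and this number serves as an induction measure.
\<close>

lemma span_exchange:
  fixes V :: "'a::complex_vector set"
  assumes "finite B" "w \<in> cvs.span (V \<union> B)" "w \<notin> cvs.span V"
  obtains b where "b \<in> B" "cvs.span (V \<union> B) \<subseteq> cvs.span (insert w V \<union> (B - {b}))"
  using assms
proof (induction B arbitrary: V thesis)
  case empty
  then show ?case by simp
next
  case (insert b B)
  show ?case
  proof (cases "w \<in> cvs.span (V \<union> B)")
    case True
    then obtain b' where b': "b' \<in> B" "cvs.span (V \<union> B) \<subseteq> cvs.span (insert w V \<union> (B - {b'}))"
      using insert.IH insert.prems by metis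
    have "V \<union> insert b B \<subseteq> cvs.span (insert w V \<union> (insert b B - {b'}))"
    proof -
      have "V \<union> B \<subseteq> cvs.span (insert w V \<union> (B - {b'}))"
        using b'(2) cvs.span_superset by blast
      also have "\<dots> \<subseteq> cvs.span (insert w V \<union> (insert b B - {b'}))"
        by (intro cvs.span_mono) auto
      finally show ?thesis
        using b'(1) insert.hyps by (auto intro: cvs.span_base)
    qed
    then have "cvs.span (V \<union> insert b B) \<subseteq> cvs.span (insert w V \<union> (insert b B - {b'}))"
      by (intro cvs.span_minimal) auto
    then show ?thesis using b'(1) by (intro insert.prems(1)[of b']) auto
  next
    case False
    have "b \<in> cvs.span (insert w (V \<union> B))"
      by (rule cvs.in_span_insert[OF _ False]) (use insert.prems(2) in simp)
    then have "V \<union> insert b B \<subseteq> cvs.span (insert w V \<union> (insert b B - {b}))"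
      using insert.hyps by (auto intro: cvs.span_base)
    then have "cvs.span (V \<union> insert b B) \<subseteq> cvs.span (insert w V \<union> (insert b B - {b}))"
      by (intro cvs.span_minimal) auto
    then show ?thesis by (intro insert.prems(1)[of b]) auto
  qed
qed

text \<open>
  Wherever the chain grows, the exchange lemma removes an element of \<open>B\<close>; so it grows at most
  \<open>card B\<close> times.
\<close>

lemma increasing_cofinite_subspaces_stabilise:
  fixes V :: "nat \<Rightarrow> 'a::complex_vector set"
  assumes "finite B" "\<And>n. cvs.subspace (V n)" "\<And>n. V n \<subseteq> V (Suc n)"
    "\<And>n. V n \<subseteq> cvs.span (V 0 \<union> B)"
  shows "\<exists>p. \<forall>n\<ge>p. V n = V p"
  using assms
proof (induction "card B" arbitrary: B V rule: less_induct)
  case less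
  have mono: "V m \<subseteq> V n" if "m \<le> n" for m n
    using less.prems(3) that by (rule lift_Suc_mono_le)
  show ?case
  proof (cases "\<forall>n. V n = V 0")
    case True
    then show ?thesis by blast
  next
    case False
    then obtain m where "V m \<noteq> V 0" by auto
    then obtain w where w: "w \<in> V m" "w \<notin> V 0" using mono[of 0 m] by auto
    then obtain b where b: "b \<in> B" "cvs.span (V 0 \<union> B) \<subseteq> cvs.span (insert w (V 0) \<union> (B - {b}))"
      using span_exchange[OF less.prems(1), of w "V 0"] less.prems(4) cvs.span_eq_iff less.prems(2)
      by (metis subsetD)
    have ins: "insert w (V 0) \<union> (B - {b}) \<subseteq> V m \<union> (B - {b})" using w mono[of 0 m] by auto
    have "\<exists>p. \<forall>n\<ge>p. V (m + n) = V (m + p)"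
    proof (rule less.hyps[of "B - {b}"])
      show "card (B - {b}) < card B" using b less.prems(1) by (intro card_Diff1_less)
      show "V (m + n) \<subseteq> cvs.span (V (m + 0) \<union> (B - {b}))" for n
        using less.prems(4)[of "m + n"] b(2) cvs.span_mono[OF ins] by simp
    qed (use less.prems in auto)
    then obtain p where p: "\<forall>n\<ge>p. V (m + n) = V (m + p)" by auto
    have "V n = V (m + p)" if "n \<ge> m + p" for n
      using p[rule_format, of "n - m"] that by simp
    then show ?thesis by blast
  qed
qed

lemma inter_span_insert_trivial:
  fixes R :: "'a::complex_vector set"
  assumes "cvs.subspace R" "R \<inter> cvs.span C = {0}" "b \<notin> cvs.span (R \<union> C)"
  shows "R \<inter> cvs.span (insert b C) = {0}"
proof -
  have "r = 0" if r: "r \<in> R" "r \<in> cvs.span (insert b C)" for r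
  proof -
    obtain k where k: "r - k *\<^sub>C b \<in> cvs.span C"
      using r(2) by (auto simp: cvs.span_breakdown_eq)
    have "k = 0"
    proof (rule ccontr)
      assume "k \<noteq> 0"
      have "r \<in> cvs.span (R \<union> C)" "r - k *\<^sub>C b \<in> cvs.span (R \<union> C)"
        using r k cvs.span_mono[of C "R \<union> C"] by (auto intro: cvs.span_base)
      then have "r - (r - k *\<^sub>C b) \<in> cvs.span (R \<union> C)" by (rule cvs.span_diff)
      then have "inverse k *\<^sub>C (r - (r - k *\<^sub>C b)) \<in> cvs.span (R \<union> C)"
        by (rule cvs.span_scale)
      then show False using assms(3) \<open>k \<noteq> 0\<close> by simp
    qed
    then show ?thesis using k r assms(2) by auto
  qed
  moreover have "0 \<in> R \<inter> cvs.span (insert b C)"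
    using cvs.subspace_0[OF assms(1)] by (simp add: cvs.span_zero)
  ultimately show ?thesis by blast
qed

lemma complement_in_spanning_set:
  fixes R :: "'a::complex_vector set"
  assumes "finite B" "cvs.subspace R"
  obtains C where "C \<subseteq> B" "R \<inter> cvs.span C = {0}" "cvs.span (R \<union> C) = cvs.span (R \<union> B)"
  using assms
proof (induction B arbitrary: thesis)
  case empty
  then show ?case using cvs.subspace_0 by (intro empty.prems(1)[of "{}"]) auto
next
  case (insert b B)
  obtain C where C: "C \<subseteq> B" "R \<inter> cvs.span C = {0}" "cvs.span (R \<union> C) = cvs.span (R \<union> B)"
    using insert.IH insert.prems by metis
  show ?case
  proof (cases "b \<in> cvs.span (R \<union> C)")
    case True
    then have "cvs.span (R \<union> insert b B) = cvs.span (R \<union> B)"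
      using C(3) by (simp add: cvs.span_redundant)
    then show ?thesis using C by (intro insert.prems(1)[of C]) auto
  next
    case False
    have "R \<inter> cvs.span (insert b C) = {0}"
      by (rule inter_span_insert_trivial[OF insert.prems(2) C(2) False])
    moreover have "cvs.span (R \<union> insert b C) = cvs.span (R \<union> insert b B)"
      using C(3) by (simp add: cvs.span_insert)
    ultimately show ?thesis using C(1) by (intro insert.prems(1)[of "insert b C"]) auto
  qed
qed

lemma mem_span_Un_iff:
  assumes "cvs.subspace R"
  shows "x \<in> cvs.span (R \<union> C) \<longleftrightarrow> (\<exists>r\<in>R. \<exists>f\<in>cvs.span C. x = r + f)"
proof -
  have "cvs.span R = R" using assms by (simp only: cvs.span_eq_iff)
  then have "cvs.span (R \<union> C) = {r + f | r f. r \<in> R \<and> f \<in> cvs.span C}"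
    by (simp only: cvs.span_Un)
  then show ?thesis by blast
qed

section \<open>Finite-dimensional extensions of closed subspaces\<close>

text \<open>
  If the ball of radius \<open>d\<close> around \<open>v\<close> misses \<open>N\<close>, dividing \<open>x + c v\<close> by \<open>c\<close> gives the estimate. It
  says that the coordinate along \<open>v\<close> is a bounded functional on \<open>N + span {v}\<close>.
\<close>

lemma scalar_bounded_by_distance:
  fixes N :: "'a::complex_normed_vector set"
  assumes N: "cvs.subspace N" "closed N" and v: "v \<notin> N"
  obtains d where "d > 0" "\<And>x c. x \<in> N \<Longrightarrow> d * cmod c \<le> norm (x + c *\<^sub>C v)"
proof -
  obtain d where d: "d > 0" "\<And>x. dist x v < d \<Longrightarrow> x \<notin> N"
  proof -
    have "open (- N)" "v \<in> - N" using N v by auto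
    then show ?thesis using that unfolding open_dist by blast
  qed
  have "d * cmod c \<le> norm (x + c *\<^sub>C v)" if x: "x \<in> N" for x c
  proof (cases "c = 0")
    case False
    have "(- inverse c) *\<^sub>C x \<in> N" using x N by (intro cvs.subspace_scale)
    then have "d \<le> dist ((- inverse c) *\<^sub>C x) v" using d(2) by force
    also have "\<dots> = norm (- ((- inverse c) *\<^sub>C x - v))" by (simp only: dist_norm norm_minus_cancel)
    also have "- ((- inverse c) *\<^sub>C x - v) = inverse c *\<^sub>C (x + c *\<^sub>C v)"
      using False by (simp add: scaleC_add_right scaleC_one)
    also have "norm \<dots> = norm (x + c *\<^sub>C v) / cmod c"
      by (simp add: norm_scaleC norm_inverse divide_inverse mult.commute)
    finally show ?thesis using False by (simp add: field_simps)
  qed auto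
  then show ?thesis using d(1) that by blast
qed

lemma closed_span_insert:
  fixes N :: "'a::complex_banach set"
  assumes N: "cvs.subspace N" "closed N"
  shows "closed (cvs.span (insert v N))"
proof (cases "v \<in> N")
  case True
  then show ?thesis using N by (simp add: insert_absorb cvs.span_eq_iff[THEN iffD2])
next
  case False
  have memI: "x + c *\<^sub>C v \<in> cvs.span (insert v N)" if "x \<in> N" for x c
    using that by (intro cvs.span_add cvs.span_scale) (auto intro: cvs.span_base)
  obtain d where d: "d > 0" "\<And>x c. x \<in> N \<Longrightarrow> d * cmod c \<le> norm (x + c *\<^sub>C v)"
    using scalar_bounded_by_distance[OF N False] by metis
  show ?thesis
    unfolding closed_sequential_limits
  proof clarify
    fix u l assume u: "\<forall>n. u n \<in> cvs.span (insert v N)" and l: "u \<longlonglongrightarrow> l"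
    have "\<forall>n. \<exists>c. u n - c *\<^sub>C v \<in> N"
      using u N by (auto simp: cvs.span_breakdown_eq cvs.span_eq_iff[THEN iffD2])
    then obtain c where c: "\<And>n. u n - c n *\<^sub>C v \<in> N" by metis
    have diff: "d * cmod (c m - c n) \<le> norm (u m - u n)" for m n
    proof -
      have "(u m - c m *\<^sub>C v) - (u n - c n *\<^sub>C v) \<in> N" by (rule cvs.subspace_diff[OF N(1) c c])
      from d(2)[OF this, of "c m - c n"] show ?thesis
        by (simp add: cvs.scale_left_diff_distrib algebra_simps)
    qed
    have "Cauchy c"
      unfolding Cauchy_def
    proof clarify
      fix e :: real assume "e > 0"
      then obtain M where M: "\<And>m n. m \<ge> M \<Longrightarrow> n \<ge> M \<Longrightarrow> norm (u m - u n) < d * e"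
        using LIMSEQ_imp_Cauchy[OF l] d(1) unfolding Cauchy_def dist_norm
        by (metis mult_pos_pos)
      have "dist (c m) (c n) < e" if "m \<ge> M" "n \<ge> M" for m n
        using le_less_trans[OF diff M[OF that]] d(1) by (simp add: dist_norm)
      then show "\<exists>M. \<forall>m\<ge>M. \<forall>n\<ge>M. dist (c m) (c n) < e" by blast
    qed
    then obtain k where k: "c \<longlonglongrightarrow> k" by (auto simp: Cauchy_convergent_iff convergent_def)
    have "(\<lambda>n. c n *\<^sub>C v) \<longlonglongrightarrow> k *\<^sub>C v"
    proof (rule LIM_zero_cancel, rule Lim_null_comparison)
      show "\<forall>\<^sub>F n in sequentially. norm (c n *\<^sub>C v - k *\<^sub>C v) \<le> cmod (c n - k) * norm v"
        by (simp add: norm_scaleC flip: cvs.scale_left_diff_distrib)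
      show "(\<lambda>n. cmod (c n - k) * norm v) \<longlonglongrightarrow> 0"
        using k by (intro tendsto_mult_left_zero tendsto_norm_zero LIM_zero)
    qed
    then have "(\<lambda>n. u n - c n *\<^sub>C v) \<longlonglongrightarrow> l - k *\<^sub>C v" using l by (intro tendsto_diff)
    then have "l - k *\<^sub>C v \<in> N" by (rule closed_sequentially[OF N(2) c])
    then show "l \<in> cvs.span (insert v N)" using memI[of "l - k *\<^sub>C v" k] by simp
  qed
qed

lemma closed_span_Un_finite:
  fixes N :: "'a::complex_banach set"
  assumes "finite B" "cvs.subspace N" "closed N"
  shows "closed (cvs.span (N \<union> B))"
  using assms
proof (induction B)
  case empty
  then have "cvs.span N = N" by (simp only: cvs.span_eq_iff)
  then show ?case using empty(2) by (simp only: Un_empty_right)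
next
  case (insert b B)
  have "closed (cvs.span (insert b (cvs.span (N \<union> B))))"
    using insert by (intro closed_span_insert) auto
  moreover have "cvs.span (insert b (cvs.span (N \<union> B))) = cvs.span (N \<union> insert b B)"
    by (simp add: cvs.span_insert cvs.span_span)
  ultimately show ?case by simp
qed

lemma closed_span_finite:
  fixes B :: "'a::complex_banach set"
  assumes "finite B"
  shows "closed (cvs.span B)"
proof -
  have "cvs.span ({0} \<union> B) = cvs.span B" using cvs.span_insert_0[of B] by simp
  then show ?thesis using closed_span_Un_finite[OF assms, of "{0}"] by (simp add: cvs.subspace_single_0)
qed

section \<open>Bounded operators with range of finite codimension\<close>

lemma cblinfun_apply_add: "cblinfun_apply S (x + y) = cblinfun_apply S x + cblinfun_apply S y"
  by (rule linear_add[OF bounded_linear.linear[OF bounded_linear_cblinfun_apply]])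

lemma cblinfun_apply_diff: "cblinfun_apply S (x - y) = cblinfun_apply S x - cblinfun_apply S y"
  by (rule linear_diff[OF bounded_linear.linear[OF bounded_linear_cblinfun_apply]])

lemma cblinfun_apply_0: "cblinfun_apply S 0 = 0"
  by (rule linear_0[OF bounded_linear.linear[OF bounded_linear_cblinfun_apply]])

lemmas cblinfun_apply_linear =
  cblinfun_apply_add cblinfun_apply_diff cblinfun_apply_0 cblinfun_apply_scaleC

lemma bounded_clinear_add: "bounded_clinear f \<Longrightarrow> f (x + y) = f x + f y"
  by (simp add: bounded_clinear_def bounded_linear.linear linear_add)

lemma bounded_clinear_diff: "bounded_clinear f \<Longrightarrow> f (x - y) = f x - f y"
  by (simp add: bounded_clinear_def bounded_linear.linear linear_diff)

lemma bounded_clinear_0: "bounded_clinear f \<Longrightarrow> f 0 = 0"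
  by (simp add: bounded_clinear_def bounded_linear.linear linear_0)

lemma bounded_clinear_funpow:
  fixes f :: "'a::complex_normed_vector \<Rightarrow> 'a"
  assumes "bounded_clinear f"
  shows "bounded_clinear (f ^^ n)"
proof (induction n)
  case 0
  have "f ^^ 0 = (\<lambda>x. x)" by auto
  then show ?case by (simp only: bounded_clinear_def bounded_linear_ident) simp
next
  case (Suc n)
  then show ?case using assms
    by (simp add: bounded_clinear_def o_def bounded_linear_compose)
qed

lemma csubspace_image:
  assumes "bounded_clinear f" "cvs.subspace V"
  shows "cvs.subspace (f ` V)"
proof (rule cvs.subspaceI)
  show "0 \<in> f ` V"
    using bounded_clinear_0[OF assms(1)] cvs.subspace_0[OF assms(2)] by force
next
  fix x y assume "x \<in> f ` V" "y \<in> f ` V"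
  then obtain a b where "a \<in> V" "b \<in> V" "x = f a" "y = f b" by auto
  then show "x + y \<in> f ` V"
    using cvs.subspace_add[OF assms(2)] by (auto simp flip: bounded_clinear_add[OF assms(1)])
next
  fix c x assume "x \<in> f ` V"
  then obtain a where "a \<in> V" "x = f a" by auto
  then show "c *\<^sub>C x \<in> f ` V"
    using cvs.subspace_scale[OF assms(2)] by (auto simp flip: bounded_clinear_scaleC[OF assms(1)])
qed

lemma csubspace_vimage:
  assumes "bounded_clinear f" "cvs.subspace V"
  shows "cvs.subspace (f -` V)"
  by (rule cvs.subspaceI)
    (simp_all add: bounded_clinear_0[OF assms(1)] bounded_clinear_add[OF assms(1)]
      bounded_clinear_scaleC[OF assms(1)] cvs.subspace_0 cvs.subspace_add cvs.subspace_scale assms(2))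

lemma image_span_subset:
  assumes "bounded_clinear f"
  shows "f ` cvs.span A \<subseteq> cvs.span (f ` A)"
proof -
  have "cvs.span A \<subseteq> f -` cvs.span (f ` A)"
    by (rule cvs.span_minimal) (auto intro: cvs.span_base csubspace_vimage[OF assms])
  then show ?thesis by auto
qed

text \<open>
  Adding to \<open>G\<close> the identity of a finite-dimensional algebraic complement of its range makes the map
  onto \<open>W\<close>, so that the open mapping theorem applies although the range of \<open>G\<close> is not yet known to be
  closed.
\<close>

lemma cofinite_range_splitting:
  fixes G :: "'a::complex_banach \<Rightarrow> 'b::complex_banach"
  assumes G: "bounded_clinear G" and V: "closed_csubspace V" and W: "closed_csubspace W"
    and B: "finite B" "B \<subseteq> W" and GV: "G ` V \<subseteq> W" "W \<subseteq> cvs.span (G ` V \<union> B)"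
  obtains C K where "finite C" "C \<subseteq> B" "G ` V \<inter> cvs.span C = {0}" "K > 0"
    "\<And>y. y \<in> W \<Longrightarrow> \<exists>x\<in>V. \<exists>f\<in>cvs.span C. y = G x + f \<and> norm x \<le> K * norm y \<and> norm f \<le> K * norm y"
proof -
  note V' = closed_csubspaceD[OF V] and W' = closed_csubspaceD[OF W]
  have sub: "cvs.subspace (G ` V)" using csubspace_image[OF G] V' by blast
  obtain C where C: "C \<subseteq> B" "G ` V \<inter> cvs.span C = {0}"
      "cvs.span (G ` V \<union> C) = cvs.span (G ` V \<union> B)"
    using complement_in_spanning_set[OF B(1) sub] by metis
  have finC: "finite C" using C(1) B(1) by (rule finite_subset)
  have CW: "cvs.span C \<subseteq> W" using C(1) B(2) W' by (intro cvs.span_minimal) auto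
  have lin: "bounded_linear (\<lambda>z. G (fst z) + snd z)"
    by (intro bounded_linear_add bounded_linear_compose[OF bounded_clinear_linear[OF G]]
        bounded_linear_fst bounded_linear_snd)
  have img: "(\<lambda>z. G (fst z) + snd z) ` (V \<times> cvs.span C) = W"
  proof
    show "(\<lambda>z. G (fst z) + snd z) ` (V \<times> cvs.span C) \<subseteq> W"
      using GV(1) CW W' by (auto intro!: cvs.subspace_add)
    show "W \<subseteq> (\<lambda>z. G (fst z) + snd z) ` (V \<times> cvs.span C)"
    proof
      fix y assume "y \<in> W"
      then have "y \<in> cvs.span (G ` V \<union> C)" using GV(2) C(3) by auto
      then obtain x f where "x \<in> V" "f \<in> cvs.span C" "y = G x + f"
        using mem_span_Un_iff[OF sub] by auto
      then show "y \<in> (\<lambda>z. G (fst z) + snd z) ` (V \<times> cvs.span C)"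
        by (intro image_eqI[of _ _ "(x, f)"]) auto
    qed
  qed
  have "subspace (V \<times> cvs.span C)" "closed (V \<times> cvs.span C)"
    using V' finC by (auto intro!: subspace_Times closed_Times subspace_of_csubspace closed_span_finite)
  then obtain K where K: "K > 0"
      "\<And>y. y \<in> W \<Longrightarrow> \<exists>z\<in>V \<times> cvs.span C. G (fst z) + snd z = y \<and> norm z \<le> K * norm y"
    using open_mapping_subspaces[OF lin _ _ _ _ img] W' by metis
  have "\<exists>x\<in>V. \<exists>f\<in>cvs.span C. y = G x + f \<and> norm x \<le> K * norm y \<and> norm f \<le> K * norm y"
    if y: "y \<in> W" for y
  proof -
    obtain z where z: "z \<in> V \<times> cvs.span C" "G (fst z) + snd z = y" "norm z \<le> K * norm y"
      using K(2)[OF y] by blast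
    then show ?thesis
      using norm_fst_le[of "fst z" "snd z"] norm_snd_le[of "snd z" "fst z"]
      by (intro bexI[of _ "fst z"] bexI[of _ "snd z"]) auto
  qed
  then show ?thesis using that finC C K(1) by blast
qed

text \<open>
  The component of a vector in the complement of the range is bounded by its norm and does not change
  when an element of the range is subtracted; so it vanishes for limits of elements of the range.
\<close>

lemma cofinite_range_closed:
  fixes G :: "'a::complex_banach \<Rightarrow> 'b::complex_banach"
  assumes G: "bounded_clinear G" and V: "closed_csubspace V" and W: "closed_csubspace W"
    and B: "finite B" "B \<subseteq> W" and GV: "G ` V \<subseteq> W" "W \<subseteq> cvs.span (G ` V \<union> B)"
  shows "closed_csubspace (G ` V)"
proof -
  note V' = closed_csubspaceD[OF V] and W' = closed_csubspaceD[OF W]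
  have sub: "cvs.subspace (G ` V)" using csubspace_image[OF G] V' by blast
  obtain C K where C: "finite C" "C \<subseteq> B" "G ` V \<inter> cvs.span C = {0}" and K: "K > 0"
    and split: "\<And>y. y \<in> W \<Longrightarrow>
      \<exists>x\<in>V. \<exists>f\<in>cvs.span C. y = G x + f \<and> norm x \<le> K * norm y \<and> norm f \<le> K * norm y"
    using cofinite_range_splitting[OF assms] by metis
  have "closed (G ` V)"
    unfolding closed_sequential_limits
  proof clarify
    fix u y assume u: "\<forall>n. u n \<in> G ` V" and l: "u \<longlonglongrightarrow> y"
    have y: "y \<in> W" using closed_sequentially[of W u y] u l GV(1) W' by blast
    obtain x0 f0 where f0: "x0 \<in> V" "f0 \<in> cvs.span C" "y = G x0 + f0" using split[OF y] by blast
    have le: "norm f0 \<le> K * norm (y - u n)" for n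
    proof -
      have "y - u n \<in> W" using y u GV(1) W' by (auto intro!: cvs.subspace_diff)
      then obtain x f where f: "x \<in> V" "f \<in> cvs.span C" "y - u n = G x + f" "norm f \<le> K * norm (y - u n)"
        using split by blast
      have "f0 - f = G x + u n - G x0" using f(3) f0(3) by (simp add: algebra_simps)
      also have "\<dots> \<in> G ` V"
        using f(1) f0(1) u sub by (intro cvs.subspace_diff cvs.subspace_add) auto
      finally have "f0 - f \<in> G ` V \<inter> cvs.span C"
        using f(2) f0(2) by (simp add: cvs.span_diff)
      then show ?thesis using f(4) C(3) by simp
    qed
    have "(\<lambda>n. K * norm (y - u n)) \<longlonglongrightarrow> K * norm (y - y)" using l by (intro tendsto_intros)
    then have "norm f0 \<le> 0" using le by (intro LIMSEQ_le_const[of _ "0::real"]) auto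
    then show "y \<in> G ` V" using f0 by auto
  qed
  then show ?thesis using sub by (simp add: closed_csubspace_def)
qed

section \<open>Ranges of the powers of an operator\<close>

lemma range_powers_decreasing:
  assumes "f ` M \<subseteq> M" "m \<le> n"
  shows "(f ^^ n) ` M \<subseteq> (f ^^ m) ` M"
proof -
  have inv: "(f ^^ k) ` M \<subseteq> M" for k
    by (induction k) (use assms(1) in auto)
  have "(f ^^ n) ` M = (f ^^ m) ` ((f ^^ (n - m)) ` M)"
    using assms(2) by (simp add: image_comp flip: funpow_add)
  then show ?thesis using inv[of "n - m"] by (simp add: image_mono)
qed

lemma range_powers_subset:
  assumes "f ` M \<subseteq> M"
  shows "(f ^^ n) ` M \<subseteq> M"
  using range_powers_decreasing[OF assms, of 0 n] by simp

text \<open>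
  The power \<open>f ^^ n\<close> identifies \<open>M / (f M + ker (f ^^ n))\<close> with the quotient of consecutive ranges
  \<open>f ^^ n M / f ^^ Suc n M\<close>. Once \<open>f M + ker (f ^^ n)\<close> has stabilised, \<open>f\<close> induces injections between
  these quotients, so a kernel vector in one range has to lie in the next.
\<close>

lemma eventually_kernel_in_next_range:
  fixes f :: "'a::complex_normed_vector \<Rightarrow> 'a"
  assumes f: "bounded_clinear f" and M: "cvs.subspace M" "f ` M \<subseteq> M"
    and B: "finite B" "M \<subseteq> cvs.span (f ` M \<union> B)"
  obtains p where "\<And>n x. n \<ge> p \<Longrightarrow> x \<in> (f ^^ n) ` M \<Longrightarrow> f x = 0 \<Longrightarrow> x \<in> (f ^^ Suc n) ` M"
proof -
  define V where "V n = {w + k |w k. w \<in> f ` M \<and> k \<in> M \<inter> (f ^^ n) -` {0}}" for n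
  note fn = bounded_clinear_funpow[OF f]
  have V0: "V 0 = f ` M" using cvs.subspace_0[OF M(1)] by (auto simp: V_def)
  have "\<exists>p. \<forall>n\<ge>p. V n = V p"
  proof (rule increasing_cofinite_subspaces_stabilise[OF B(1)])
    show "cvs.subspace (V n)" for n
      unfolding V_def
      by (intro cvs.subspace_sums csubspace_image[OF f] cvs.subspace_inter M csubspace_vimage[OF fn]
          cvs.subspace_single_0)
    show "V n \<subseteq> V (Suc n)" for n
      using bounded_clinear_0[OF f] by (force simp: V_def)
    show "V n \<subseteq> cvs.span (V 0 \<union> B)" for n
      unfolding V0 using B(2) M cvs.subspace_add[OF M(1)] by (fastforce simp: V_def)
  qed
  then obtain p where p: "\<And>n. n \<ge> p \<Longrightarrow> V n = V p" by blast
  have "x \<in> (f ^^ Suc n) ` M" if n: "n \<ge> p" and x: "x \<in> (f ^^ n) ` M" "f x = 0" for n x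
  proof -
    obtain y where y: "y \<in> M" "x = (f ^^ n) y" using x(1) by auto
    have "0 \<in> f ` M" "y \<in> M \<inter> (f ^^ Suc n) -` {0}"
      using y x(2) csubspace_image[OF f M(1), THEN cvs.subspace_0] by auto
    then have "0 + y \<in> V (Suc n)"
      unfolding V_def by blast
    then have "y \<in> V n" using p[OF n] p[of "Suc n"] n by simp
    then obtain w k where wk: "w \<in> M" "(f ^^ n) k = 0" "y = f w + k" by (auto simp: V_def)
    then have "x = (f ^^ Suc n) w"
      using y(2) by (simp add: bounded_clinear_add[OF fn] funpow_swap1)
    then show ?thesis using wk(1) by blast
  qed
  then show ?thesis using that by blast
qed

lemma range_powers_cofinite:
  fixes f :: "'a::complex_normed_vector \<Rightarrow> 'a"
  assumes f: "bounded_clinear f" and M: "cvs.subspace M" "f ` M \<subseteq> M"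
    and B: "finite B" "B \<subseteq> M" "M \<subseteq> cvs.span (f ` M \<union> B)"
  shows "\<exists>A. finite A \<and> A \<subseteq> M \<and> M \<subseteq> cvs.span ((f ^^ n) ` M \<union> A)"
proof (induction n)
  case 0
  show ?case by (intro exI[of _ "{}"]) (auto intro: cvs.span_base)
next
  case (Suc n)
  then obtain A where A: "finite A" "A \<subseteq> M" "M \<subseteq> cvs.span ((f ^^ n) ` M \<union> A)" by blast
  have "f ` M \<subseteq> f ` cvs.span ((f ^^ n) ` M \<union> A)" using A(3) by (rule image_mono)
  also have "\<dots> \<subseteq> cvs.span (f ` ((f ^^ n) ` M \<union> A))" by (rule image_span_subset[OF f])
  also have "\<dots> = cvs.span ((f ^^ Suc n) ` M \<union> f ` A)" by (simp add: image_Un image_comp)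
  also have "\<dots> \<subseteq> cvs.span ((f ^^ Suc n) ` M \<union> (f ` A \<union> B))" by (intro cvs.span_mono) auto
  finally have "f ` M \<union> B \<subseteq> cvs.span ((f ^^ Suc n) ` M \<union> (f ` A \<union> B))"
    by (auto intro: cvs.span_base)
  then have "cvs.span (f ` M \<union> B) \<subseteq> cvs.span ((f ^^ Suc n) ` M \<union> (f ` A \<union> B))"
    by (intro cvs.span_minimal) auto
  then show ?case
    using A(1,2) B M(2) by (intro exI[of _ "f ` A \<union> B"]) blast
qed

section \<open>Pulling functionals back along an operator\<close>

definition clinear_on :: "'a::complex_vector set \<Rightarrow> ('a \<Rightarrow> complex) \<Rightarrow> bool"
  where "clinear_on L \<phi> \<longleftrightarrow> (\<forall>x\<in>L. \<forall>y\<in>L. \<phi> (x + y) = \<phi> x + \<phi> y)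
    \<and> (\<forall>c. \<forall>x\<in>L. \<phi> (c *\<^sub>C x) = c * \<phi> x)"

lemma clinear_onD:
  assumes "clinear_on L \<phi>" "cvs.subspace L"
  shows "x \<in> L \<Longrightarrow> y \<in> L \<Longrightarrow> \<phi> (x + y) = \<phi> x + \<phi> y"
    and "x \<in> L \<Longrightarrow> \<phi> (c *\<^sub>C x) = c * \<phi> x"
    and "x \<in> L \<Longrightarrow> y \<in> L \<Longrightarrow> \<phi> (x - y) = \<phi> x - \<phi> y"
proof -
  show add: "\<phi> (x + y) = \<phi> x + \<phi> y" if "x \<in> L" "y \<in> L" for x y
    using that assms(1) by (simp add: clinear_on_def)
  show "x \<in> L \<Longrightarrow> \<phi> (c *\<^sub>C x) = c * \<phi> x"
    using assms(1) by (simp add: clinear_on_def)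
  show "\<phi> (x - y) = \<phi> x - \<phi> y" if "x \<in> L" "y \<in> L"
    using add[of "x - y" y] that cvs.subspace_diff[OF assms(2)] by simp
qed

text \<open>
  A minimal spanning set \<open>C\<close> of \<open>L\<close> modulo \<open>R\<close> gives a closed hyperplane \<open>H\<close> of \<open>span (R \<union> C)\<close>
  that contains \<open>R\<close>; the functional is the coordinate modulo \<open>H\<close>. Finite codimension replaces the
  Hahn-Banach theorem here.
\<close>

lemma functional_vanishing_on_cofinite_subspace:
  fixes R L :: "'a::complex_banach set"
  assumes R: "closed_csubspace R" "R \<subseteq> L" "R \<noteq> L"
    and B: "finite B" "L \<subseteq> cvs.span (R \<union> B)"
  obtains \<phi> K e where "clinear_on L \<phi>" "\<And>x. x \<in> L \<Longrightarrow> cmod (\<phi> x) \<le> K * norm x" "K > 0"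
    "\<And>x. x \<in> R \<Longrightarrow> \<phi> x = 0" "e \<in> L" "\<phi> e \<noteq> 0"
proof -
  note R' = closed_csubspaceD[OF R(1)]
  obtain C where C: "finite C" "L \<subseteq> cvs.span (R \<union> C)"
    and min: "\<And>D. finite D \<Longrightarrow> L \<subseteq> cvs.span (R \<union> D) \<Longrightarrow> card C \<le> card D"
    using ex_has_least_nat[of "\<lambda>C. finite C \<and> L \<subseteq> cvs.span (R \<union> C)" B card] B by metis
  have "cvs.span (R \<union> {}) = R" using R' by simp
  then have "C \<noteq> {}" using C R(2,3) by blast
  then obtain e where e: "e \<in> C" by auto
  define H where "H = cvs.span (R \<union> (C - {e}))"
  have H: "cvs.subspace H" "closed H"
    unfolding H_def using C(1) R' by (auto intro: closed_span_Un_finite)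
  have LH: "\<not> L \<subseteq> H"
    using min[of "C - {e}"] C(1) e card_Diff1_less[OF C(1) e] by (auto simp: H_def)
  have span: "cvs.span (R \<union> C) = cvs.span (insert e H)"
    unfolding H_def using e by (simp add: cvs.span_insert[of e "cvs.span _"] cvs.span_span)
       (metis Un_insert_right cvs.span_insert insert_Diff)
  have eH: "e \<notin> H"
  proof
    assume "e \<in> H"
    then have "cvs.span (insert e H) = H" using H(1) by (simp add: insert_absorb)
    then show False using C(2) span LH by simp
  qed
  obtain d where d: "d > 0" "\<And>x c. x \<in> H \<Longrightarrow> d * cmod c \<le> norm (x + c *\<^sub>C e)"
    using scalar_bounded_by_distance[OF H eH] by metis
  have uniq: "c = c'" if "x - c *\<^sub>C e \<in> H" "x - c' *\<^sub>C e \<in> H" for x c c'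
  proof -
    have "(x - c *\<^sub>C e) - (x - c' *\<^sub>C e) \<in> H" using that by (rule cvs.subspace_diff[OF H(1)])
    from d(2)[OF this, of "c - c'"] have "d * cmod (c - c') \<le> 0"
      by (simp add: cvs.scale_left_diff_distrib)
    then show ?thesis using d(1) by (simp add: mult_le_0_iff)
  qed
  define \<phi> where "\<phi> x = (THE c. x - c *\<^sub>C e \<in> H)" for x
  have eq: "\<phi> x = c" if "x - c *\<^sub>C e \<in> H" for x c
    unfolding \<phi>_def using that uniq by blast
  have mem: "x - \<phi> x *\<^sub>C e \<in> H" if "x \<in> L" for x
  proof -
    have "x \<in> cvs.span (insert e H)" using that C(2) span by auto
    moreover have "cvs.span H = H" using H(1) by simp
    ultimately obtain c where "x - c *\<^sub>C e \<in> H" by (auto simp: cvs.span_breakdown_eq)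
    then show ?thesis using eq by metis
  qed
  have "clinear_on L \<phi>"
    unfolding clinear_on_def
  proof (intro conjI ballI allI eq)
    fix x y assume "x \<in> L" "y \<in> L"
    then have "(x - \<phi> x *\<^sub>C e) + (y - \<phi> y *\<^sub>C e) \<in> H"
      by (intro cvs.subspace_add[OF H(1)] mem)
    then show "x + y - (\<phi> x + \<phi> y) *\<^sub>C e \<in> H"
      by (simp add: scaleC_add_left algebra_simps)
  next
    fix c x assume "x \<in> L"
    then have "c *\<^sub>C (x - \<phi> x *\<^sub>C e) \<in> H" by (intro cvs.subspace_scale[OF H(1)] mem)
    then show "c *\<^sub>C x - (c * \<phi> x) *\<^sub>C e \<in> H"
      by (simp add: cvs.scale_right_diff_distrib)
  qed
  moreover have "cmod (\<phi> x) \<le> inverse d * norm x" if "x \<in> L" for x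
    using d(2)[OF mem[OF that], of "\<phi> x"] d(1) by (simp add: field_simps)
  moreover have "\<phi> x = 0" if "x \<in> R" for x
    using that by (intro eq) (auto simp: H_def intro: cvs.span_base)
  moreover obtain u where "u \<in> L" "u \<notin> H" using LH by auto
  moreover from this have "\<phi> u \<noteq> 0" using mem[of u] by auto
  ultimately show ?thesis using d(1) by (intro that[of \<phi> "inverse d" u]) auto
qed

text \<open>
  Let \<open>b\<close> choose, with control of the norm, a preimage of the component of a vector in \<open>S L\<close>. The
  functionals are \<open>\<phi> n = \<phi> 0 \<circ> b ^^ n\<close>. The map \<open>b\<close> itself is linear only modulo the kernel of
  \<open>S\<close>; but \<open>\<phi> n\<close> vanishes on \<open>(S ^^ Suc n) ` L\<close>, which contains that kernel by hypothesis, and so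
  \<open>\<phi> (Suc n) = \<phi> n \<circ> b\<close> is linear again and inverts composition with \<open>S\<close>.
\<close>

lemma functionals_pulled_back_along_operator:
  fixes S :: "'a::complex_banach \<Rightarrow> 'a"
  assumes S: "bounded_clinear S" and L: "closed_csubspace L" "S ` L \<subseteq> L" "S ` L \<noteq> L"
    and B: "finite B" "B \<subseteq> L" "L \<subseteq> cvs.span (S ` L \<union> B)"
    and ker: "\<And>n x. x \<in> L \<Longrightarrow> S x = 0 \<Longrightarrow> x \<in> (S ^^ n) ` L"
  obtains \<phi> K c e where "\<And>n. clinear_on L (\<phi> n)" "K > 0" "c > 0"
    "\<And>n x. x \<in> L \<Longrightarrow> cmod (\<phi> n x) \<le> K * c ^ n * norm x"
    "\<And>x. x \<in> L \<Longrightarrow> \<phi> 0 (S x) = 0" "\<And>n x. x \<in> L \<Longrightarrow> \<phi> (Suc n) (S x) = \<phi> n x"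
    "e \<in> L" "\<phi> 0 e \<noteq> 0"
proof -
  note L' = closed_csubspaceD[OF L(1)]
  have sub: "cvs.subspace (S ` L)" using csubspace_image[OF S] L' by blast
  obtain \<phi>0 K e where \<phi>0: "clinear_on L \<phi>0" "\<And>x. x \<in> L \<Longrightarrow> cmod (\<phi>0 x) \<le> K * norm x" "K > 0"
      "\<And>x. x \<in> S ` L \<Longrightarrow> \<phi>0 x = 0" "e \<in> L" "\<phi>0 e \<noteq> 0"
    using functional_vanishing_on_cofinite_subspace
      [OF cofinite_range_closed[OF S L(1) L(1) B(1,2) L(2) B(3)] L(2,3) B(1,3)] by metis
  obtain C c where C: "S ` L \<inter> cvs.span C = {0}" "c > 0" and split: "\<And>y. y \<in> L \<Longrightarrow>
      \<exists>x\<in>L. \<exists>f\<in>cvs.span C. y = S x + f \<and> norm x \<le> c * norm y \<and> norm f \<le> c * norm y"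
    using cofinite_range_splitting[OF S L(1) L(1) B(1,2) L(2) B(3)] by metis
  then obtain b where b: "\<And>y. y \<in> L \<Longrightarrow> b y \<in> L \<and> y - S (b y) \<in> cvs.span C \<and> norm (b y) \<le> c * norm y"
    by (metis add_diff_cancel_left')
  have uniq: "S u = S v" if "u \<in> L" "v \<in> L" "y - S u \<in> cvs.span C" "y - S v \<in> cvs.span C" for u v y
  proof -
    have "(y - S u) - (y - S v) \<in> cvs.span C" by (rule cvs.span_diff[OF that(3,4)])
    moreover have "(y - S u) - (y - S v) \<in> S ` L"
      using cvs.subspace_diff[OF sub imageI[OF that(2)] imageI[OF that(1)]] by simp
    ultimately have "(y - S u) - (y - S v) = 0" using C(1) by blast
    then show ?thesis by simp
  qed
  define \<phi> where "\<phi> n = (\<lambda>x. \<phi>0 ((b ^^ n) x))" for n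
  have \<phi>_Suc: "\<phi> (Suc n) x = \<phi> n (b x)" for n x
    by (simp add: \<phi>_def funpow_swap1)
  have inv: "clinear_on L (\<phi> n) \<and> (\<forall>x\<in>L. \<phi> n ((S ^^ Suc n) x) = 0)
      \<and> (\<forall>x\<in>L. \<phi> (Suc n) (S x) = \<phi> n x)" for n
  proof (induction n)
    \<comment> \<open>\<open>\<phi> n\<close> depends on its argument only modulo the kernel of \<open>S\<close>.\<close>
    have cong: "\<phi> n u = \<phi> n v"
      if lin: "clinear_on L (\<phi> n)" and van: "\<forall>x\<in>L. \<phi> n ((S ^^ Suc n) x) = 0"
        and uv: "u \<in> L" "v \<in> L" "S u = S v" for n u v
    proof -
      have "u - v \<in> (S ^^ Suc n) ` L"
        using uv L' by (intro ker) (auto simp: bounded_clinear_diff[OF S] cvs.subspace_diff)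
      then have "\<phi> n (u - v) = 0" using van by auto
      then show ?thesis using clinear_onD(3)[OF lin _ uv(1,2)] L' by auto
    qed
    have step: "\<phi> (Suc n) (S x) = \<phi> n x"
      if "clinear_on L (\<phi> n)" "\<forall>x\<in>L. \<phi> n ((S ^^ Suc n) x) = 0" "x \<in> L" for n x
      unfolding \<phi>_Suc
    proof (rule cong[OF that(1,2)])
      have Sx: "S x \<in> L" using that(3) L(2) by auto
      then show "b (S x) \<in> L" using b by blast
      show "S (b (S x)) = S x"
        by (rule uniq[of _ _ "S x"]) (use b Sx that(3) in \<open>auto simp: cvs.span_zero\<close>)
    qed (rule that(3))
    {
      case 0
      have "clinear_on L (\<phi> 0)" using \<phi>0(1) by (simp add: \<phi>_def)
      moreover have "\<forall>x\<in>L. \<phi> 0 ((S ^^ Suc 0) x) = 0" using \<phi>0(4) by (simp add: \<phi>_def)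
      ultimately show ?case using step by blast
    next
      case (Suc n)
      then have lin: "clinear_on L (\<phi> n)" and van: "\<forall>x\<in>L. \<phi> n ((S ^^ Suc n) x) = 0"
        and st: "\<forall>x\<in>L. \<phi> (Suc n) (S x) = \<phi> n x" by auto
      note linD = clinear_onD[OF lin conjunct1[OF L']]
      have "clinear_on L (\<phi> (Suc n))"
        unfolding clinear_on_def \<phi>_Suc
      proof (intro conjI ballI allI)
        fix x y assume xy: "x \<in> L" "y \<in> L"
        have add: "x + y \<in> L" "b x + b y \<in> L" using xy b L' by (auto intro: cvs.subspace_add)
        have "(x - S (b x)) + (y - S (b y)) \<in> cvs.span C" using b xy by (intro cvs.span_add) auto
        then have "x + y - S (b x + b y) \<in> cvs.span C"
          by (simp add: bounded_clinear_add[OF S] algebra_simps)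
        then have "\<phi> n (b (x + y)) = \<phi> n (b x + b y)"
          using add b[OF add(1)] by (intro cong[OF lin van] uniq[of _ _ "x + y"]) auto
        then show "\<phi> n (b (x + y)) = \<phi> n (b x) + \<phi> n (b y)" using linD(1) b xy by auto
      next
        fix a x assume x: "x \<in> L"
        have sc: "a *\<^sub>C x \<in> L" "a *\<^sub>C b x \<in> L" using x b L' by (auto intro: cvs.subspace_scale)
        have "a *\<^sub>C (x - S (b x)) \<in> cvs.span C" using b x by (intro cvs.span_scale) auto
        then have "a *\<^sub>C x - S (a *\<^sub>C b x) \<in> cvs.span C"
          by (simp add: bounded_clinear_scaleC[OF S] cvs.scale_right_diff_distrib)
        then have "\<phi> n (b (a *\<^sub>C x)) = \<phi> n (a *\<^sub>C b x)"
          using sc b[OF sc(1)] by (intro cong[OF lin van] uniq[of _ _ "a *\<^sub>C x"]) auto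
        then show "\<phi> n (b (a *\<^sub>C x)) = a * \<phi> n (b x)" using linD(2) b x by auto
      qed
      moreover have "\<forall>x\<in>L. \<phi> (Suc n) ((S ^^ Suc (Suc n)) x) = 0"
      proof
        fix x assume x: "x \<in> L"
        then have "(S ^^ Suc n) x \<in> L" using range_powers_subset[OF L(2)] by blast
        then show "\<phi> (Suc n) ((S ^^ Suc (Suc n)) x) = 0" using st van x by simp
      qed
      ultimately show ?case using step by blast
    }
  qed
  have bound: "cmod (\<phi> n x) \<le> K * c ^ n * norm x" if "x \<in> L" for n x
    using that
  proof (induction n arbitrary: x)
    case 0
    then show ?case using \<phi>0(2) by (simp add: \<phi>_def)
  next
    case (Suc n)
    have "cmod (\<phi> (Suc n) x) \<le> K * c ^ n * norm (b x)"
      unfolding \<phi>_Suc using b Suc by blast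
    also have "\<dots> \<le> K * c ^ n * (c * norm x)"
      using b Suc.prems \<phi>0(3) C(2) by (intro mult_left_mono) auto
    finally show ?case by (simp add: mult_ac)
  qed
  show ?thesis
  proof (rule that[of \<phi> K c e])
    show "\<phi> 0 (S x) = 0" if "x \<in> L" for x using \<phi>0(4) that by (simp add: \<phi>_def)
    show "\<phi> 0 e \<noteq> 0" using \<phi>0(6) by (simp add: \<phi>_def)
  qed (use inv bound \<phi>0 C in auto)
qed

section \<open>Analytic families of eigenvectors of the adjoint\<close>

lemma bounded_projection:
  fixes M N :: "'a::complex_banach set"
  assumes M: "closed_csubspace M" and N: "closed_csubspace N" and MN: "M \<inter> N = {0}"
    and UN: "{m + n |m n. m \<in> M \<and> n \<in> N} = UNIV"
  obtains P where "bounded_clinear P" "\<And>x. P x \<in> M" "\<And>x. x - P x \<in> N" "\<And>x. x \<in> M \<Longrightarrow> P x = x"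
proof -
  note M' = closed_csubspaceD[OF M] and N' = closed_csubspaceD[OF N]
  have uniq: "m = m'" if "m \<in> M" "m' \<in> M" "x - m \<in> N" "x - m' \<in> N" for m m' x
  proof -
    have "m - m' \<in> M" using that(1,2) M' by (intro cvs.subspace_diff) auto
    moreover have "(x - m') - (x - m) \<in> N" using cvs.subspace_diff[OF _ that(4,3)] N' by blast
    ultimately have "m - m' \<in> M \<inter> N" by simp
    then show ?thesis using MN by simp
  qed
  have ex: "\<exists>m\<in>M. x - m \<in> N" for x
  proof -
    have "x \<in> {m + n |m n. m \<in> M \<and> n \<in> N}" using UN by simp
    then show ?thesis by force
  qed
  define P where "P x = (SOME m. m \<in> M \<and> x - m \<in> N)" for x
  have P: "P x \<in> M \<and> x - P x \<in> N" for x
    using someI_ex[of "\<lambda>m. m \<in> M \<and> x - m \<in> N"] ex[of x] unfolding P_def by blast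
  have P_eq: "P x = m" if "m \<in> M" "x - m \<in> N" for x m
    using uniq[of "P x" m x] P that by blast
  have img: "(\<lambda>z. fst z + snd z) ` (M \<times> N) = UNIV"
  proof -
    have "(\<lambda>z. fst z + snd z) ` (M \<times> N) = {m + n |m n. m \<in> M \<and> n \<in> N}" by force
    then show ?thesis using UN by simp
  qed
  have "subspace (M \<times> N)" "closed (M \<times> N)"
    using M' N' by (auto intro: subspace_Times closed_Times)
  moreover have "bounded_linear (\<lambda>z. fst z + snd z :: 'a)"
    by (intro bounded_linear_intros)
  ultimately obtain C where C: "\<And>y. \<exists>z\<in>M \<times> N. fst z + snd z = y \<and> norm z \<le> C * norm y"
    using open_mapping_subspaces[OF _ _ _ _ _ img] by (metis UNIV_I closed_UNIV subspace_UNIV)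
  have "bounded_linear P"
  proof (rule bounded_linear_intro[where K = C])
    fix x y :: 'a and r :: real
    have "(x - P x) + (y - P y) \<in> N" using P N' cvs.subspace_add by blast
    then show "P (x + y) = P x + P y"
      using P M' by (intro P_eq cvs.subspace_add) (auto simp: algebra_simps)
    have "r *\<^sub>R (x - P x) \<in> N" using P N' by (intro subspace_scale) auto
    then show "P (r *\<^sub>R x) = r *\<^sub>R P x"
      using P M' by (intro P_eq subspace_scale) (auto simp: scaleR_right_diff_distrib)
    obtain z where z: "z \<in> M \<times> N" "fst z + snd z = x" "norm z \<le> C * norm x"
      using C[of x] by blast
    then have "P x = fst z" by (intro P_eq) auto
    then show "norm (P x) \<le> norm x * C"
      using z(3) norm_fst_le[of "fst z" "snd z"] by (simp add: mult.commute)
  qed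
  moreover have "P (c *\<^sub>C x) = c *\<^sub>C P x" for c x
  proof -
    have "c *\<^sub>C (x - P x) \<in> N" using P N' by (intro cvs.subspace_scale) auto
    then show ?thesis
      using P M' by (intro P_eq cvs.subspace_scale) (auto simp: cvs.scale_right_diff_distrib)
  qed
  ultimately have "bounded_clinear P" by (simp add: bounded_clinear_def)
  moreover have "P x = x" if "x \<in> M" for x
    using that N' by (intro P_eq) (auto simp: cvs.subspace_0)
  ultimately show ?thesis using P that by blast
qed

lemma bounded_linear_scaleC_left: "bounded_linear (\<lambda>c. c *\<^sub>C (x :: 'a::complex_normed_vector))"
  by (rule bounded_linear_intro[where K = "norm x"])
    (simp_all add: scaleC_add_left scaleR_scaleC scaleC_scaleC norm_scaleC scaleC_complex_def)

text \<open>
  The radius \<open>1 / (2 * c)\<close>, half of the guaranteed radius of convergence, makes the series and its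
  termwise derivative uniformly dominated by \<open>\<Sum> (1/2)^n\<close> and \<open>\<Sum> n (1/2)^n\<close>.
\<close>

lemma power_series_canalytic:
  fixes \<psi> :: "nat \<Rightarrow> 'b::complex_banach" and \<mu> :: complex
  assumes \<psi>: "\<And>n. norm (\<psi> n) \<le> K * c ^ n" and c: "c > 0"
    and f_def: "f = (\<lambda>z. \<Sum>n. (z - \<mu>) ^ n *\<^sub>C \<psi> n)"
  shows "canalytic_on f (ball \<mu> (1 / (2 * c)))"
    and "z \<in> ball \<mu> (1 / (2 * c)) \<Longrightarrow> (\<lambda>n. (z - \<mu>) ^ n *\<^sub>C \<psi> n) sums f z"
proof -
  let ?U = "ball \<mu> (1 / (2 * c))"
  have K: "K \<ge> 0" using \<psi>[of 0] norm_ge_zero[of "\<psi> 0"] by (simp del: norm_ge_zero)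
  have r: "cmod (z - \<mu>) \<le> 1 / (2 * c)" if "z \<in> ?U" for z
    using that by (simp add: dist_norm norm_minus_commute)
  have sums: "(\<lambda>n. (z - \<mu>) ^ n *\<^sub>C \<psi> n) sums f z" if z: "z \<in> ?U" for z
  proof -
    have "norm ((z - \<mu>) ^ n *\<^sub>C \<psi> n) \<le> K * (1/2) ^ n" for n
    proof -
      have "norm ((z - \<mu>) ^ n *\<^sub>C \<psi> n) \<le> (1 / (2 * c)) ^ n * (K * c ^ n)"
        unfolding norm_scaleC norm_power using r[OF z] \<psi> c by (intro mult_mono power_mono) auto
      also have "\<dots> = K * (1/2) ^ n" using c by (simp add: power_divide power_mult_distrib)
      finally show ?thesis .
    qed
    then have "summable (\<lambda>n. (z - \<mu>) ^ n *\<^sub>C \<psi> n)"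
      by (intro summable_comparison_test'[OF summable_mult[OF summable_geometric]]) auto
    then show ?thesis unfolding f_def by (rule summable_sums)
  qed
  then show "z \<in> ?U \<Longrightarrow> (\<lambda>n. (z - \<mu>) ^ n *\<^sub>C \<psi> n) sums f z" .
  define D where "D z n = (of_nat n * (z - \<mu>) ^ (n - 1)) *\<^sub>C \<psi> n" for z n
  have bound: "norm (D z n) \<le> K * c * 2 * (real n * (1/2) ^ n)" if "z \<in> ?U" for z n
  proof (cases n)
    case (Suc k)
    have "norm (D z n) \<le> (real n * (1 / (2 * c)) ^ k) * (K * c ^ Suc k)"
      unfolding D_def norm_scaleC norm_power norm_mult Suc diff_Suc_1 norm_of_nat
      using r[OF that] \<psi>[of "Suc k"] c K by (intro mult_mono power_mono order_refl) auto
    also have "\<dots> = K * c * 2 * (real n * (1/2) ^ n)"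
      using c Suc by (simp add: power_divide power_mult_distrib)
    finally show ?thesis .
  qed (simp add: D_def)
  have "summable (\<lambda>n. of_nat n * (1/2::real) ^ n)"
  proof -
    have "summable (\<lambda>n. 1/2 * (of_nat (Suc n) * (1/2::real) ^ n))"
      using geometric_deriv_sums[of "1/2::real"] by (intro summable_mult sums_summable) auto
    then have "summable (\<lambda>n. of_nat (Suc n) * (1/2::real) ^ Suc n)"
      by (simp add: mult_ac)
    then show ?thesis by (subst (asm) summable_Suc_iff)
  qed
  then have unif: "uniform_limit ?U (\<lambda>n z. \<Sum>i<n. D z i) (\<lambda>z. \<Sum>i. D z i) sequentially"
    by (intro Weierstrass_m_test[OF bound] summable_mult)
  have "\<exists>g. \<forall>z\<in>?U. (\<lambda>n. (z - \<mu>) ^ n *\<^sub>C \<psi> n) sums g z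
      \<and> (g has_derivative (\<lambda>h. h *\<^sub>C (\<Sum>i. D z i))) (at z within ?U)"
  proof (rule has_derivative_series)
    fix n z
    have "((\<lambda>z. (z - \<mu>) ^ n) has_derivative (\<lambda>h. h * (of_nat n * (z - \<mu>) ^ (n - 1)))) (at z within ?U)"
      by (auto intro!: derivative_eq_intros)
    from bounded_linear.has_derivative[OF bounded_linear_scaleC_left this, of "\<psi> n"]
    show "((\<lambda>z. (z - \<mu>) ^ n *\<^sub>C \<psi> n) has_derivative (\<lambda>h. h *\<^sub>C D z n)) (at z within ?U)"
      by (simp add: D_def)
  next
    fix e :: real assume "e > 0"
    from uniform_limitD[OF unif this]
    show "\<forall>\<^sub>F n in sequentially. \<forall>z\<in>?U. \<forall>h.
        norm ((\<Sum>i<n. h *\<^sub>C D z i) - h *\<^sub>C (\<Sum>i. D z i)) \<le> e * norm h"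
    proof eventually_elim
      case (elim n)
      have "norm ((\<Sum>i<n. h *\<^sub>C D z i) - h *\<^sub>C (\<Sum>i. D z i)) \<le> e * norm h" if z: "z \<in> ?U" for z h
      proof -
        have "(\<Sum>i<n. h *\<^sub>C D z i) - h *\<^sub>C (\<Sum>i. D z i) = h *\<^sub>C ((\<Sum>i<n. D z i) - (\<Sum>i. D z i))"
          by (simp add: cvs.scale_right_diff_distrib cvs.scale_sum_right)
        then show ?thesis
          using mult_left_mono[OF less_imp_le[OF elim[rule_format, OF z]], of "cmod h"]
          by (simp add: norm_scaleC dist_norm mult.commute)
      qed
      then show ?case by blast
    qed
  next
    show "\<mu> \<in> ?U" using c by simp
    then show "(\<lambda>n. (\<mu> - \<mu>) ^ n *\<^sub>C \<psi> n) sums f \<mu>" by (rule sums)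
  qed simp
  then obtain g where g: "\<And>z. z \<in> ?U \<Longrightarrow> (\<lambda>n. (z - \<mu>) ^ n *\<^sub>C \<psi> n) sums g z"
      "\<And>z. z \<in> ?U \<Longrightarrow> (g has_derivative (\<lambda>h. h *\<^sub>C (\<Sum>i. D z i))) (at z within ?U)"
    by blast
  have fg: "f z = g z" if "z \<in> ?U" for z
    using g(1) sums that sums_unique2 by blast
  show "canalytic_on f ?U"
    unfolding canalytic_on_def
  proof
    fix z assume z: "z \<in> ?U"
    have "(f has_derivative (\<lambda>h. h *\<^sub>C (\<Sum>i. D z i))) (at z within ?U)"
      using g(2)[OF z] z fg by (rule has_derivative_transform[rotated 2])
    then show "\<exists>D. (f has_derivative (\<lambda>h. h *\<^sub>C D)) (at z)"
      using at_within_open[OF z open_ball] by auto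
  qed
qed

lemma bounded_linear_evaluation:
  "bounded_linear (\<lambda>f. cblinfun_apply f x)"
proof (rule bounded_linear_intro[where K = "norm x"])
  fix f g :: "'a \<Rightarrow>\<^sub>C\<^sub>L 'b" and r :: real
  show "cblinfun_apply (f + g) x = cblinfun_apply f x + cblinfun_apply g x"
    by (simp add: plus_cblinfun.rep_eq)
  show "cblinfun_apply (r *\<^sub>R f) x = r *\<^sub>R cblinfun_apply f x"
    by (simp add: scaleR_cblinfun_def scaleC_cblinfun.rep_eq scaleR_scaleC)
  show "norm (cblinfun_apply f x) \<le> norm f * norm x"
    by (rule norm_cblinfun)
qed

lemma shift_apply: "cblinfun_apply (T - \<mu> *\<^sub>C id_cblinfun) x = cblinfun_apply T x - \<mu> *\<^sub>C x"
  by (simp add: minus_cblinfun.rep_eq scaleC_cblinfun.rep_eq id_cblinfun.rep_eq)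

lemma cadjoint_shift_eq_0_iff:
  "cblinfun_apply (cadjoint T - z *\<^sub>C id_cblinfun) \<phi> = 0
    \<longleftrightarrow> (\<forall>x. cblinfun_apply \<phi> (cblinfun_apply T x) = z * cblinfun_apply \<phi> x)"
proof -
  have "cblinfun_apply (cblinfun_apply (cadjoint T - z *\<^sub>C id_cblinfun) \<phi>) x
      = cblinfun_apply \<phi> (cblinfun_apply T x) - z * cblinfun_apply \<phi> x" for x
    by (simp add: shift_apply minus_cblinfun.rep_eq scaleC_cblinfun.rep_eq cadjoint.rep_eq
        cblinfun_compose.rep_eq scaleC_complex_def id_cblinfun.rep_eq)
  then show ?thesis
    by (metis cblinfun_eqI eq_iff_diff_eq_0 zero_cblinfun.rep_eq)
qed

text \<open>
  The chain condition says precisely that multiplying the power series with coefficients \<open>\<psi> n\<close> by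
  \<open>z - \<mu>\<close> is the same as composing it with \<open>T - \<mu>\<close>.
\<close>

lemma adjoint_SVEP_fails:
  fixes T :: "'a::complex_banach \<Rightarrow>\<^sub>C\<^sub>L 'a" and \<psi> :: "nat \<Rightarrow> 'a cdual"
  assumes \<psi>: "\<And>n. norm (\<psi> n) \<le> K * c ^ n" and c: "c > 0"
    and eig: "\<And>x. cblinfun_apply (\<psi> 0) (cblinfun_apply (T - \<mu> *\<^sub>C id_cblinfun) x) = 0"
      "\<And>n x. cblinfun_apply (\<psi> (Suc n)) (cblinfun_apply (T - \<mu> *\<^sub>C id_cblinfun) x) = cblinfun_apply (\<psi> n) x"
    and nz: "\<psi> 0 \<noteq> 0"
  shows "\<not> SVEP_at (cadjoint T) \<mu>"
proof
  assume SVEP: "SVEP_at (cadjoint T) \<mu>"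
  let ?U = "ball \<mu> (1 / (2 * c))"
  let ?S = "cblinfun_apply (T - \<mu> *\<^sub>C id_cblinfun)"
  define f where "f z = (\<Sum>n. (z - \<mu>) ^ n *\<^sub>C \<psi> n)" for z
  have ana: "canalytic_on f ?U" and sums: "\<And>z. z \<in> ?U \<Longrightarrow> (\<lambda>n. (z - \<mu>) ^ n *\<^sub>C \<psi> n) sums f z"
    using power_series_canalytic[OF \<psi> c f_def[abs_def, THEN meta_eq_to_obj_eq]] by auto
  have f_apply: "(\<lambda>n. (z - \<mu>) ^ n * cblinfun_apply (\<psi> n) x) sums cblinfun_apply (f z) x"
    if "z \<in> ?U" for z x
    using bounded_linear.sums[OF bounded_linear_evaluation sums[OF that], of x]
    by (simp add: scaleC_cblinfun.rep_eq scaleC_complex_def)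
  have "cblinfun_apply (cadjoint T - z *\<^sub>C id_cblinfun) (f z) = 0" if z: "z \<in> ?U" for z
    unfolding cadjoint_shift_eq_0_iff
  proof
    fix x
    have "(\<lambda>n. (z - \<mu>) * ((z - \<mu>) ^ n * cblinfun_apply (\<psi> n) x)) sums ((z - \<mu>) * cblinfun_apply (f z) x)"
      by (rule sums_mult[OF f_apply[OF z]])
    then have "(\<lambda>n. (z - \<mu>) ^ Suc n * cblinfun_apply (\<psi> (Suc n)) (?S x)) sums ((z - \<mu>) * cblinfun_apply (f z) x)"
      by (simp add: eig mult.assoc)
    from sums_Suc[OF this] f_apply[OF z, of "?S x"]
    have "cblinfun_apply (f z) (?S x) = (z - \<mu>) * cblinfun_apply (f z) x"
      using sums_unique2 by (fastforce simp: eig)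
    moreover have "cblinfun_apply T x = ?S x + \<mu> *\<^sub>C x" by (simp add: shift_apply)
    ultimately show "cblinfun_apply (f z) (cblinfun_apply T x) = z * cblinfun_apply (f z) x"
      by (simp add: cblinfun_apply_linear scaleC_complex_def algebra_simps)
  qed
  moreover have \<mu>: "\<mu> \<in> ?U" using c by simp
  ultimately have "f \<mu> = 0"
    using SVEP ana unfolding SVEP_at_def by (meson connected_ball open_ball)
  moreover have "f \<mu> = \<psi> 0"
  proof (rule cblinfun_eqI)
    fix x
    have "(\<lambda>n. (\<mu> - \<mu>) ^ n * cblinfun_apply (\<psi> n) x) sums cblinfun_apply (\<psi> 0) x"
      using powser_sums_zero[of "\<lambda>n. cblinfun_apply (\<psi> n) x"] by (simp add: mult.commute)
    then show "cblinfun_apply (f \<mu>) x = cblinfun_apply (\<psi> 0) x"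
      using f_apply[OF \<mu>] sums_unique2 by blast
  qed
  ultimately show False using nz by simp
qed

lemma RedD:
  assumes "(M, N) \<in> Red S"
  shows "closed_csubspace M" "closed_csubspace N" "cblinfun_apply S ` M \<subseteq> M" "cblinfun_apply S ` N \<subseteq> N"
    "M \<inter> N = {0}" "{m + n |m n. m \<in> M \<and> n \<in> N} = UNIV"
  using assms by (simp_all add: Red_def)

section \<open>From the SVEP of the adjoint to surjectivity\<close>

text \<open>
  If the ranges of the powers of \<open>S\<close> on \<open>M\<close> kept shrinking, the adjoint would have an analytic
  family of eigenvectors near \<open>\<mu>\<close>, built from functionals on \<open>L = (S ^^ p) ` M\<close> that are pulled back to
  the whole space by \<open>Q = S ^^ p \<circ> P\<close>, where \<open>P\<close> is the projection onto \<open>M\<close> along \<open>N\<close>. Composing with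
  \<open>S ^^ p\<close>, and not merely extending from \<open>L\<close>, is what makes the first functional vanish on all of
  \<open>S ` M\<close>, since \<open>(S ^^ p) ` (S ` M) = S ` L\<close>.
\<close>

lemma finite_descent_of_adjoint_SVEP:
  fixes T :: "'a::complex_banach \<Rightarrow>\<^sub>C\<^sub>L 'a" and \<mu> :: complex
  defines "S \<equiv> cblinfun_apply (T - \<mu> *\<^sub>C id_cblinfun)"
  assumes Red: "(M, N) \<in> Red (T - \<mu> *\<^sub>C id_cblinfun)"
    and B: "finite B" "B \<subseteq> M" "M \<subseteq> cvs.span (S ` M \<union> B)"
    and SVEP: "SVEP_at (cadjoint T) \<mu>"
  obtains p where "(S ^^ Suc p) ` M = (S ^^ p) ` M" "closed_csubspace ((S ^^ p) ` M)"
proof -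
  note Red' = RedD[OF Red, folded S_def]
  note M' = closed_csubspaceD[OF Red'(1)] and N' = closed_csubspaceD[OF Red'(2)]
  have S: "bounded_clinear S" unfolding S_def by (rule bounded_clinear_cblinfun_apply)
  note Sn = bounded_clinear_funpow[OF S]
  obtain p where p: "\<And>n x. n \<ge> p \<Longrightarrow> x \<in> (S ^^ n) ` M \<Longrightarrow> S x = 0 \<Longrightarrow> x \<in> (S ^^ Suc n) ` M"
    using eventually_kernel_in_next_range[OF S _ Red'(3) B(1,3)] M' by metis
  define L where "L = (S ^^ p) ` M"
  have SnL: "(S ^^ n) ` L = (S ^^ (n + p)) ` M" for n
    by (simp add: L_def image_comp funpow_add)
  have LM: "L \<subseteq> M" unfolding L_def by (rule range_powers_subset[OF Red'(3)])
  obtain A where A: "finite A" "A \<subseteq> M" "M \<subseteq> cvs.span (L \<union> A)"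
    using range_powers_cofinite[OF S _ Red'(3) B, of p] M' unfolding L_def by blast
  have L: "closed_csubspace L"
    unfolding L_def
    by (rule cofinite_range_closed[OF Sn Red'(1) Red'(1) A(1,2)]) (use LM A(3) in \<open>auto simp: L_def\<close>)
  have SLL: "S ` L \<subseteq> L"
    using SnL[of 1] range_powers_decreasing[OF Red'(3), of p "Suc p"] by (simp add: L_def)
  have "S ` L = L"
  proof (rule ccontr)
    assume ne: "S ` L \<noteq> L"
    have Lspan: "L \<subseteq> cvs.span (S ` L \<union> (S ^^ p) ` B)"
    proof -
      have "L \<subseteq> (S ^^ p) ` cvs.span (S ` M \<union> B)" unfolding L_def using B(3) by (rule image_mono)
      also have "\<dots> \<subseteq> cvs.span ((S ^^ p) ` (S ` M \<union> B))" by (rule image_span_subset[OF Sn])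
      also have "(S ^^ p) ` (S ` M \<union> B) = S ` L \<union> (S ^^ p) ` B"
        by (simp add: L_def image_Un image_comp o_def funpow_swap1)
      finally show ?thesis .
    qed
    have ker: "x \<in> (S ^^ n) ` L" if "x \<in> L" "S x = 0" for n x
    proof (induction n)
      case 0
      then show ?case using that by simp
    next
      case (Suc n)
      then show ?case using p[of "n + p" x] that(2) unfolding SnL by simp
    qed
    have BL: "finite ((S ^^ p) ` B)" "(S ^^ p) ` B \<subseteq> L"
      using B(1,2) by (auto simp: L_def)
    obtain \<phi> K c e where \<phi>: "\<And>n. clinear_on L (\<phi> n)" "K > 0" "c > 0"
        "\<And>n x. x \<in> L \<Longrightarrow> cmod (\<phi> n x) \<le> K * c ^ n * norm x"
        "\<And>x. x \<in> L \<Longrightarrow> \<phi> 0 (S x) = 0" "\<And>n x. x \<in> L \<Longrightarrow> \<phi> (Suc n) (S x) = \<phi> n x"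
        "e \<in> L" "\<phi> 0 e \<noteq> 0"
      using functionals_pulled_back_along_operator[OF S L SLL ne BL Lspan ker] by metis
    obtain P where P: "bounded_clinear P" "\<And>x. P x \<in> M" "\<And>x. x - P x \<in> N" "\<And>x. x \<in> M \<Longrightarrow> P x = x"
      using bounded_projection[OF Red'(1,2,5,6)] by metis
    \<comment> \<open>The difference of the two sides lies in both \<open>M\<close> and \<open>N\<close>.\<close>
    have PS: "P (S x) = S (P x)" for x
    proof -
      have "P (S x) - S (P x) \<in> M"
        using P(2) Red'(3) M' by (intro cvs.subspace_diff) auto
      moreover have "S (x - P x) - (S x - P (S x)) \<in> N"
        using P(3) Red'(4) N' by (intro cvs.subspace_diff[of N "S (x - P x)"]) auto
      ultimately have "P (S x) - S (P x) \<in> M \<inter> N"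
        by (simp add: bounded_clinear_diff[OF S])
      then show ?thesis using Red'(5) by simp
    qed
    define Q where "Q x = (S ^^ p) (P x)" for x
    have Q: "bounded_clinear Q"
      using P(1) Sn[of p] by (simp add: Q_def[abs_def] bounded_clinear_def bounded_linear_compose)
    have QL: "Q x \<in> L" for x using P(2) by (simp add: Q_def L_def)
    have QS: "Q (S x) = S (Q x)" for x by (simp add: Q_def PS funpow_swap1)
    obtain q where q: "q > 0" "\<And>x. norm (Q x) \<le> norm x * q"
      using bounded_linear.pos_bounded[OF bounded_clinear_linear[OF Q]] by blast
    note lin = clinear_onD[OF \<phi>(1) conjunct1[OF closed_csubspaceD[OF L]]]
    have bound: "cmod (\<phi> n (Q x)) \<le> K * q * c ^ n * norm x" for n x
    proof -
      have "cmod (\<phi> n (Q x)) \<le> K * c ^ n * norm (Q x)" by (rule \<phi>(4)[OF QL])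
      also have "\<dots> \<le> K * c ^ n * (norm x * q)"
        using q(2) \<phi>(2,3) by (intro mult_left_mono) auto
      finally show ?thesis by (simp add: mult_ac)
    qed
    have bcl: "bounded_clinear (\<lambda>x. \<phi> n (Q x))" for n
      unfolding bounded_clinear_def
    proof
      show "bounded_linear (\<lambda>x. \<phi> n (Q x))"
        by (rule bounded_linear_intro[where K = "K * q * c ^ n"])
          (use bound in \<open>auto simp: bounded_clinear_add[OF Q] bounded_clinear_scaleC[OF Q] scaleR_scaleC
            scaleC_complex_def lin QL mult.commute\<close>)
      show "\<forall>a x. \<phi> n (Q (a *\<^sub>C x)) = a *\<^sub>C \<phi> n (Q x)"
        by (simp add: bounded_clinear_scaleC[OF Q] scaleC_complex_def lin QL)
    qed
    define \<psi> :: "nat \<Rightarrow> 'a cdual" where "\<psi> n = CBlinfun (\<lambda>x. \<phi> n (Q x))" for n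
    have \<psi>: "cblinfun_apply (\<psi> n) x = \<phi> n (Q x)" for n x
      by (simp add: \<psi>_def CBlinfun_inverse bcl)
    have "\<psi> 0 \<noteq> 0"
    proof -
      obtain u where "u \<in> M" "e = (S ^^ p) u" using \<phi>(7) by (auto simp: L_def)
      then have "cblinfun_apply (\<psi> 0) u = \<phi> 0 e" by (simp add: \<psi> Q_def P(4))
      then show ?thesis using \<phi>(8) by (auto simp: zero_cblinfun.rep_eq)
    qed
    moreover have "norm (\<psi> n) \<le> K * q * c ^ n" for n
      using bound q(1) \<phi>(2,3) by (intro norm_cblinfun_bound) (auto simp: \<psi>)
    ultimately have "\<not> SVEP_at (cadjoint T) \<mu>"
      using \<phi>(3) by (intro adjoint_SVEP_fails[of \<psi> "K * q" c]) (auto simp: \<psi> QS QL \<phi> simp flip: S_def)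
    then show False using SVEP by simp
  qed
  then show ?thesis using that[of p] L SnL[of 1] by (simp add: L_def)
qed

text \<open>
  Because \<open>S\<close> maps \<open>L\<close> onto itself, invariant subspaces can be lifted from \<open>M / L\<close>. As \<open>S\<close> is
  nilpotent on \<open>M / L\<close>, there is a vector \<open>v\<close> outside \<open>L + span C\<close> with \<open>S v\<close> inside it; subtracting
  from \<open>v\<close> a preimage in \<open>L\<close> of the \<open>L\<close>-component of \<open>S v\<close> brings \<open>S v\<close> into \<open>span C\<close>, and \<open>v\<close>
  can be added to \<open>C\<close>. The exchange lemma bounds the number of such steps.
\<close>

lemma invariant_complement:
  fixes S :: "'a::complex_normed_vector \<Rightarrow> 'a"
  assumes S: "bounded_clinear S" and M: "cvs.subspace M" "S ` M \<subseteq> M"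
    and L: "cvs.subspace L" "S ` L = L" "L \<subseteq> M" "(S ^^ p) ` M \<subseteq> L"
    and B: "finite B" "M \<subseteq> cvs.span (L \<union> B)"
  obtains C where "finite C" "cvs.span C \<subseteq> M" "S ` cvs.span C \<subseteq> cvs.span C"
    "L \<inter> cvs.span C = {0}" "M \<subseteq> cvs.span (L \<union> C)"
proof -
  have "\<exists>C'. finite C' \<and> cvs.span C' \<subseteq> M \<and> S ` cvs.span C' \<subseteq> cvs.span C'
      \<and> L \<inter> cvs.span C' = {0} \<and> M \<subseteq> cvs.span (L \<union> C')"
    if "finite B" "finite C" "cvs.span C \<subseteq> M" "S ` cvs.span C \<subseteq> cvs.span C"
      "L \<inter> cvs.span C = {0}" "M \<subseteq> cvs.span ((L \<union> C) \<union> B)" for B C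
    using that
  proof (induction "card B" arbitrary: B C rule: less_induct)
    case less
    show ?case
    proof (cases "M \<subseteq> cvs.span (L \<union> C)")
      case True
      then show ?thesis using less.prems by blast
    next
      case False
      then obtain w where w: "w \<in> M" "w \<notin> cvs.span (L \<union> C)" by auto
      \<comment> \<open>The last vector of the orbit of \<open>w\<close> outside \<open>L + span C\<close> is the vector \<open>v\<close> sought.\<close>
      define j where "j = (LEAST j. (S ^^ j) w \<in> cvs.span (L \<union> C))"
      have "(S ^^ p) w \<in> cvs.span (L \<union> C)" using w(1) L(4) by (auto intro: cvs.span_base)
      then have j: "(S ^^ j) w \<in> cvs.span (L \<union> C)" unfolding j_def by (rule LeastI)
      then have "j \<noteq> 0" using w(2) by (intro notI) simp
      then obtain i where i: "j = Suc i" by (cases j) auto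
      define v where "v = (S ^^ i) w"
      have v: "v \<in> M" "v \<notin> cvs.span (L \<union> C)" "S v \<in> cvs.span (L \<union> C)"
        using range_powers_subset[OF M(2), of i] w(1) not_less_Least[of i "\<lambda>j. (S ^^ j) w \<in> cvs.span (L \<union> C)"] j
        by (auto simp: v_def i simp flip: j_def)
      obtain l f where lf: "l \<in> L" "f \<in> cvs.span C" "S v = l + f"
        using v(3) mem_span_Un_iff[OF L(1)] by auto
      then obtain l' where l': "l' \<in> L" "l = S l'" using L(2) by auto
      define u where "u = v - l'"
      have Su: "S u = f" using lf l' by (simp add: u_def bounded_clinear_diff[OF S])
      have uM: "u \<in> M" using v(1) l' L(3) M(1) by (auto simp: u_def intro: cvs.subspace_diff)
      have uC: "u \<notin> cvs.span (L \<union> C)"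
      proof
        assume "u \<in> cvs.span (L \<union> C)"
        then have "u + l' \<in> cvs.span (L \<union> C)" using l' by (intro cvs.span_add) (auto intro: cvs.span_base)
        then show False using v(2) by (simp add: u_def)
      qed
      obtain b where b: "b \<in> B"
          "cvs.span ((L \<union> C) \<union> B) \<subseteq> cvs.span (insert u (L \<union> C) \<union> (B - {b}))"
        using span_exchange[OF less.prems(1) _ uC] uM less.prems(6) by blast
      show ?thesis
      proof (rule less.hyps[of "B - {b}" "insert u C"])
        show "card (B - {b}) < card B" using less.prems(1) b(1) by (intro card_Diff1_less)
        have "C \<subseteq> M" using less.prems(3) cvs.span_superset by blast
        then show "cvs.span (insert u C) \<subseteq> M" using uM M(1) by (intro cvs.span_minimal) auto
        have "S ` insert u C \<subseteq> cvs.span C"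
          using Su lf(2) less.prems(4) cvs.span_superset[of C] by auto
        then have "cvs.span (S ` insert u C) \<subseteq> cvs.span C" by (intro cvs.span_minimal) auto
        then show "S ` cvs.span (insert u C) \<subseteq> cvs.span (insert u C)"
          using image_span_subset[OF S, of "insert u C"] cvs.span_mono[of C "insert u C"] by blast
        show "L \<inter> cvs.span (insert u C) = {0}"
          by (rule inter_span_insert_trivial[OF L(1) less.prems(5) uC])
        show "M \<subseteq> cvs.span ((L \<union> insert u C) \<union> (B - {b}))"
          using less.prems(6) b(2) by auto
      qed (use less.prems in auto)
    qed
  qed
  from this[of B "{}"] show ?thesis
    using B cvs.subspace_0[OF M(1)] cvs.subspace_0[OF L(1)] bounded_clinear_0[OF S] that by auto
qed

text \<open>
  For \<open>z \<noteq> 0\<close>, \<open>T - z\<close> is bijective on both summands, on the nilpotent one by induction on the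
  order of nilpotency; boundedness of the inverse is the open mapping theorem.
\<close>

lemma quasinilpotent_on_sum_nilpotent:
  fixes T :: "'a::complex_banach \<Rightarrow>\<^sub>C\<^sub>L 'a"
  assumes N: "closed_csubspace N" "T ` N \<subseteq> N" "quasinilpotent_on N T"
    and C: "finite C" "T ` cvs.span C \<subseteq> cvs.span C" "N \<inter> cvs.span C = {0}"
    and nil: "\<And>x. x \<in> cvs.span C \<Longrightarrow> (cblinfun_apply T ^^ p) x = 0"
  shows "quasinilpotent_on (cvs.span (N \<union> C)) T"
proof -
  let ?N' = "cvs.span (N \<union> C)"
  note N' = closed_csubspaceD[OF N(1)]
  have mem: "x \<in> ?N' \<longleftrightarrow> (\<exists>n\<in>N. \<exists>f\<in>cvs.span C. x = n + f)" for x
    using N' by (intro mem_span_Un_iff) auto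
  have "invertible_on ?N' (T - z *\<^sub>C id_cblinfun)" if z: "z \<noteq> 0" for z
  proof -
    define R where "R = cblinfun_apply (T - z *\<^sub>C id_cblinfun)"
    have R: "bounded_clinear R" unfolding R_def by (rule bounded_clinear_cblinfun_apply)
    have RT: "R x = T x - z *\<^sub>C x" for x by (simp add: R_def shift_apply)
    have bij: "bij_betw R N N"
      using N(3) z by (auto simp: quasinilpotent_on_def spectrum_on_def invertible_on_def R_def)
    have RC: "R x \<in> cvs.span C" if "x \<in> cvs.span C" for x
      unfolding RT using that C(2) by (intro cvs.span_diff cvs.span_scale) auto
    have surjC: "\<exists>u\<in>cvs.span C. x = R u" if "x \<in> cvs.span C" "(cblinfun_apply T ^^ k) x = 0" for k x
      using that
    proof (induction k arbitrary: x)
      case 0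
      then show ?case by (intro bexI[of _ 0]) (auto simp: bounded_clinear_0[OF R] cvs.span_zero)
    next
      case (Suc k)
      then obtain u where u: "u \<in> cvs.span C" "T x = R u"
        using C(2) by (fastforce simp: funpow_swap1)
      \<comment> \<open>If \<open>T x = R u\<close>, then \<open>R (u - x) = T x - R x = z x\<close>.\<close>
      have "R (inverse z *\<^sub>C (u - x)) = inverse z *\<^sub>C (R u - R x)"
        by (simp add: bounded_clinear_scaleC[OF R] bounded_clinear_diff[OF R])
      also have "R u - R x = z *\<^sub>C x" using u(2) by (simp add: RT)
      finally have "x = R (inverse z *\<^sub>C (u - x))" using z by (simp add: scaleC_one)
      then show ?case using u(1) Suc.prems(1) by (intro bexI[of _ "inverse z *\<^sub>C (u - x)"])
          (auto intro: cvs.span_scale cvs.span_diff)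
    qed
    have injC: "x = 0" if "x \<in> cvs.span C" "R x = 0" for x
    proof -
      have "(cblinfun_apply T ^^ k) x = z ^ k *\<^sub>C x" for k
        using that(2) by (induction k) (auto simp: RT cblinfun_apply_scaleC scaleC_scaleC scaleC_one mult.commute)
      then show ?thesis using nil[OF that(1)] z by simp
    qed
    have img: "R ` ?N' = ?N'"
    proof
      show "R ` ?N' \<subseteq> ?N'"
      proof clarify
        fix x assume "x \<in> ?N'"
        then obtain n f where "n \<in> N" "f \<in> cvs.span C" "x = n + f" using mem by auto
        then show "R x \<in> ?N'"
          unfolding mem using bij RC by (auto simp: bounded_clinear_add[OF R] bij_betw_def)
      qed
      show "?N' \<subseteq> R ` ?N'"
      proof
        fix x assume "x \<in> ?N'"
        then obtain n f where nf: "n \<in> N" "f \<in> cvs.span C" "x = n + f" using mem by auto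
        obtain u where u: "u \<in> cvs.span C" "f = R u" using surjC[OF nf(2) nil[OF nf(2)]] by blast
        obtain m where m: "m \<in> N" "n = R m" using bij nf(1) by (auto simp: bij_betw_def)
        have "m + u \<in> ?N'" using mem m u by blast
        moreover have "x = R (m + u)" using m u nf(3) by (simp add: bounded_clinear_add[OF R])
        ultimately show "x \<in> R ` ?N'" by blast
      qed
    qed
    have inj0: "x = 0" if x: "x \<in> ?N'" "R x = 0" for x
    proof -
      obtain n f where nf: "n \<in> N" "f \<in> cvs.span C" "x = n + f" using mem x(1) by auto
      have "R n = - R f" using x(2) nf(3) by (simp add: bounded_clinear_add[OF R] eq_neg_iff_add_eq_0)
      then have "R n \<in> cvs.span C" using RC[OF nf(2)] by (simp add: cvs.span_neg)
      moreover have "R n \<in> N" using bij nf(1) by (auto simp: bij_betw_def)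
      ultimately have "R n \<in> N \<inter> cvs.span C" by blast
      then have "R n = 0" using C(3) by simp
      then have "n = 0"
        using bij nf(1) N' bounded_clinear_0[OF R] cvs.subspace_0 unfolding bij_betw_def inj_on_def by metis
      moreover have "f = 0" using injC nf(2) \<open>R n = - R f\<close> \<open>R n = 0\<close> by simp
      ultimately show ?thesis using nf(3) by simp
    qed
    have inj: "inj_on R ?N'"
    proof (rule inj_onI)
      fix x y assume xy: "x \<in> ?N'" "y \<in> ?N'" "R x = R y"
      then have "x - y \<in> ?N'" "R (x - y) = 0"
        by (simp_all add: bounded_clinear_diff[OF R] cvs.span_diff)
      then have "x - y = 0" by (rule inj0)
      then show "x = y" by simp
    qed
    have "closed ?N'" using C(1) N' by (intro closed_span_Un_finite) auto
    then obtain K where K: "\<And>y. y \<in> ?N' \<Longrightarrow> \<exists>x\<in>?N'. R x = y \<and> norm x \<le> K * norm y"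
      using open_mapping_subspaces[OF bounded_clinear_linear[OF R] _ _ _ _ img]
        subspace_of_csubspace[OF cvs.subspace_span] by metis
    have "norm x \<le> K * norm (R x)" if "x \<in> ?N'" for x
      using K[of "R x"] img inj that by (metis imageI inj_onD)
    then show ?thesis
      unfolding invertible_on_def using inj img by (auto simp: bij_betw_def simp flip: R_def)
  qed
  then show ?thesis by (auto simp: quasinilpotent_on_def spectrum_on_def)
qed

text \<open>
  The surjective part is the stable range \<open>L\<close> in \<open>M\<close>; its invariant complement in \<open>M\<close> is nilpotent and
  is absorbed into the quasi-nilpotent part.
\<close>

lemma gD_surjective_of_adjoint_SVEP:
  fixes T :: "'a::complex_banach \<Rightarrow>\<^sub>C\<^sub>L 'a"
  assumes Red: "(M, N) \<in> Red (T - \<mu> *\<^sub>C id_cblinfun)"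
    and fin: "lower_semi_Fredholm_on M (T - \<mu> *\<^sub>C id_cblinfun)"
    and qn: "quasinilpotent_on N (T - \<mu> *\<^sub>C id_cblinfun)"
    and SVEP: "SVEP_at (cadjoint T) \<mu>"
  shows "gD_surjective (T - \<mu> *\<^sub>C id_cblinfun)"
proof -
  define A where "A = T - \<mu> *\<^sub>C id_cblinfun"
  define S where "S = cblinfun_apply A"
  note Red' = RedD[OF Red, folded A_def, folded S_def]
  note M' = closed_csubspaceD[OF Red'(1)] and N' = closed_csubspaceD[OF Red'(2)]
  have S: "bounded_clinear S" unfolding S_def by (rule bounded_clinear_cblinfun_apply)
  have "{B. finite B \<and> B \<subseteq> M \<and> M \<subseteq> cvs.span (S ` M \<union> B)} \<noteq> {}"
    using fin unfolding lower_semi_Fredholm_on_def ecodim_def S_def A_def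
    by (intro notI) (simp add: top_enat_def)
  then obtain B where B: "finite B" "B \<subseteq> M" "M \<subseteq> cvs.span (S ` M \<union> B)" by blast
  obtain p where p: "(S ^^ Suc p) ` M = (S ^^ p) ` M" "closed_csubspace ((S ^^ p) ` M)"
    using finite_descent_of_adjoint_SVEP[OF Red B(1,2) _ SVEP] B(3) unfolding S_def A_def by metis
  define L where "L = (S ^^ p) ` M"
  have SL: "S ` L = L" using p(1) by (simp add: L_def image_comp)
  have LM: "L \<subseteq> M" unfolding L_def by (rule range_powers_subset[OF Red'(3)])
  have L: "closed_csubspace L" using p(2) by (simp add: L_def)
  obtain D where D: "finite D" "M \<subseteq> cvs.span (L \<union> D)"
    using range_powers_cofinite[OF S _ Red'(3) B, of p] M' unfolding L_def by blast
  obtain C where C: "finite C" "cvs.span C \<subseteq> M" "S ` cvs.span C \<subseteq> cvs.span C"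
      "L \<inter> cvs.span C = {0}" "M \<subseteq> cvs.span (L \<union> C)"
    using invariant_complement[OF S _ Red'(3) _ SL LM _ D, of p] M' closed_csubspaceD[OF L]
    unfolding L_def by blast
  let ?N' = "cvs.span (N \<union> C)"
  have nil: "(S ^^ p) x = 0" if x: "x \<in> cvs.span C" for x
  proof -
    have "(S ^^ p) x \<in> cvs.span C" using range_powers_subset[OF C(3), of p] x by auto
    moreover have "(S ^^ p) x \<in> L" using x C(2) by (auto simp: L_def)
    ultimately show ?thesis using C(4) by blast
  qed
  have mem: "x \<in> ?N' \<longleftrightarrow> (\<exists>n\<in>N. \<exists>f\<in>cvs.span C. x = n + f)" for x
    using N' by (intro mem_span_Un_iff) auto
  have NC: "N \<inter> cvs.span C = {0}"
    using C(2) Red'(5) N' by (auto simp: cvs.subspace_0 cvs.span_zero)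
  have "quasinilpotent_on ?N' A"
    using quasinilpotent_on_sum_nilpotent[of N A C p] Red'(2,4) qn C(1,3) NC nil
    by (simp add: S_def A_def)
  moreover have "(L, ?N') \<in> Red A"
    unfolding Red_def
  proof (intro CollectI case_prodI conjI)
    show "closed_csubspace ?N'"
      using closed_span_Un_finite[OF C(1)] N' by (simp add: closed_csubspace_def)
    have "S ` ?N' \<subseteq> cvs.span (S ` (N \<union> C))" by (rule image_span_subset[OF S])
    also have "\<dots> \<subseteq> ?N'"
    proof (rule cvs.span_minimal)
      have "S ` C \<subseteq> cvs.span C" using C(3) cvs.span_superset by blast
      then show "S ` (N \<union> C) \<subseteq> ?N'"
        using Red'(4) cvs.span_mono[of C "N \<union> C"] by (auto intro: cvs.span_base)
    qed simp
    finally show "A ` ?N' \<subseteq> ?N'" by (simp add: S_def)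
    show "L \<inter> ?N' = {0}"
    proof
      show "L \<inter> ?N' \<subseteq> {0}"
      proof
        fix x assume x: "x \<in> L \<inter> ?N'"
        then obtain n f where nf: "n \<in> N" "f \<in> cvs.span C" "x = n + f" using mem by auto
        then have "n = x - f" by simp
        also have "\<dots> \<in> M" using x nf(2) LM C(2) M' by (intro cvs.subspace_diff) auto
        finally have "n = 0" using nf(1) Red'(5) by auto
        then show "x \<in> {0}" using nf x C(4) by auto
      qed
      show "{0} \<subseteq> L \<inter> ?N'" using closed_csubspaceD[OF L] by (auto simp: cvs.subspace_0 cvs.span_zero)
    qed
    show "{m + n |m n. m \<in> L \<and> n \<in> ?N'} = UNIV"
    proof (rule UNIV_eq_I[symmetric])
      fix x
      have "x \<in> {m + n |m n. m \<in> M \<and> n \<in> N}" using Red'(6) by simp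
      then obtain m n where mn: "m \<in> M" "n \<in> N" "x = m + n" by blast
      obtain l f where lf: "l \<in> L" "f \<in> cvs.span C" "m = l + f"
        using mn(1) C(5) mem_span_Un_iff[of L m C] closed_csubspaceD[OF L] by blast
      have "x = l + (n + f)" using mn lf by (simp add: algebra_simps)
      moreover have "n + f \<in> ?N'" using mem mn lf by blast
      ultimately show "x \<in> {m + n |m n. m \<in> L \<and> n \<in> ?N'}" using lf(1) by blast
    qed
    show "A ` L \<subseteq> L" using SL by (simp add: S_def)
  qed (rule L)
  moreover have "surjective_on L A" using SL by (simp add: surjective_on_def S_def)
  ultimately show ?thesis unfolding gD_surjective_def A_def by blast
qed

section \<open>From surjectivity to the SVEP of the adjoint\<close>

lemma gD_surjective_imp_gD_lower_semi_Weyl: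
  assumes "gD_surjective S"
  shows "gD_lower_semi_Weyl S"
proof -
  obtain M N where MN: "(M, N) \<in> Red S" "S ` M = M" "quasinilpotent_on N S"
    using assms by (auto simp: gD_surjective_def surjective_on_def)
  have "ecodim M M \<le> enat (card ({} :: 'a set))"
    unfolding ecodim_def by (intro INF_lower) (auto intro: cvs.span_base)
  then have "ecodim M (S ` M) = 0" using MN(2) by (simp flip: zero_enat_def)
  then show ?thesis
    using MN unfolding gD_lower_semi_Weyl_def lower_semi_Fredholm_on_def index_on_def
    by (intro bexI[of _ "(M, N)"]) (auto simp: enat_0_iff)
qed

text \<open>
  Writing \<open>y = S x\<close> with \<open>x\<close> of norm at most \<open>C * norm y\<close> turns a bound for \<open>\<phi>\<close> on \<open>M\<close> into one that
  is smaller by the factor \<open>cmod w * C\<close>.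
\<close>

lemma functional_eq_0_on_surjective_part:
  fixes \<phi> :: "'a::complex_banach cdual"
  assumes S: "\<And>y. y \<in> M \<Longrightarrow> \<exists>x\<in>M. S x = y \<and> norm x \<le> C * norm y"
    and eig: "\<And>x. cblinfun_apply \<phi> (S x) = w * cblinfun_apply \<phi> x"
    and small: "cmod w * C < 1" "C > 0" and y: "y \<in> M"
  shows "cblinfun_apply \<phi> y = 0"
proof -
  have le: "cmod (cblinfun_apply \<phi> y) \<le> norm \<phi> * norm y * (cmod w * C) ^ n" if "y \<in> M" for n y
    using that
  proof (induction n arbitrary: y)
    case 0
    then show ?case using norm_cblinfun[of \<phi> y] by simp
  next
    case (Suc n)
    obtain x where x: "x \<in> M" "S x = y" "norm x \<le> C * norm y" using S[OF Suc.prems] by blast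
    have "cmod (cblinfun_apply \<phi> y) = cmod w * cmod (cblinfun_apply \<phi> x)"
      using eig[of x] x(2) by (simp add: norm_mult)
    also have "\<dots> \<le> cmod w * (norm \<phi> * norm x * (cmod w * C) ^ n)"
      by (intro mult_left_mono Suc.IH x(1)) simp
    also have "\<dots> \<le> cmod w * (norm \<phi> * (C * norm y) * (cmod w * C) ^ n)"
      using x(3) small(2) by (intro mult_left_mono mult_right_mono) auto
    finally show ?case by (simp add: mult_ac)
  qed
  have "(\<lambda>n. norm \<phi> * norm y * (cmod w * C) ^ n) \<longlonglongrightarrow> norm \<phi> * norm y * 0"
    using small by (intro tendsto_mult tendsto_const LIMSEQ_power_zero) simp
  then have "cmod (cblinfun_apply \<phi> y) \<le> 0"
    using le[OF y] by (intro LIMSEQ_le_const[where X = "\<lambda>n. norm \<phi> * norm y * (cmod w * C) ^ n"]) auto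
  then show ?thesis by simp
qed

text \<open>
  Eigenvectors of the adjoint for eigenvalues near, but different from, \<open>\<mu>\<close> vanish on both parts
  of the decomposition. The exceptional point \<open>\<mu>\<close>, where nothing is known on the quasi-nilpotent
  part, is reached by analytic continuation.
\<close>

lemma adjoint_SVEP_of_gD_surjective:
  fixes T :: "'a::complex_banach \<Rightarrow>\<^sub>C\<^sub>L 'a"
  assumes "gD_surjective (T - \<mu> *\<^sub>C id_cblinfun)"
  shows "SVEP_at (cadjoint T) \<mu>"
  unfolding SVEP_at_def
proof (intro allI impI ballI, elim conjE)
  fix U f z0
  assume U: "open U" "connected U" "\<mu> \<in> U" and ana: "canalytic_on f U" and z0: "z0 \<in> U"
    and ker: "\<forall>z\<in>U. cblinfun_apply (cadjoint T - z *\<^sub>C id_cblinfun) (f z) = 0"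
  define A where "A = T - \<mu> *\<^sub>C id_cblinfun"
  obtain M N where MN: "(M, N) \<in> Red A" "A ` M = M" "quasinilpotent_on N A"
    using assms by (auto simp: gD_surjective_def surjective_on_def A_def)
  note Red' = RedD[OF MN(1)]
  obtain C where C: "C > 0" "\<And>y. y \<in> M \<Longrightarrow> \<exists>x\<in>M. A x = y \<and> norm x \<le> C * norm y"
    using open_mapping_subspaces[OF bounded_linear_cblinfun_apply _ _ _ _ MN(2)]
      closed_csubspaceD[OF Red'(1)] by metis
  have zero: "f z = 0" if z: "z \<in> U" "z \<noteq> \<mu>" "cmod (z - \<mu>) * C < 1" for z
  proof (rule cblinfun_eqI)
    fix x
    have eig: "cblinfun_apply (f z) (A y) = (z - \<mu>) * cblinfun_apply (f z) y" for y
      using ker z(1) unfolding cadjoint_shift_eq_0_iff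
      by (simp add: A_def shift_apply cblinfun_apply_linear scaleC_complex_def algebra_simps)
    have "x \<in> {m + n |m n. m \<in> M \<and> n \<in> N}" using Red'(6) by simp
    then obtain m n where mn: "m \<in> M" "n \<in> N" "x = m + n" by blast
    have "cblinfun_apply (f z) m = 0"
      by (rule functional_eq_0_on_surjective_part[OF C(2) eig z(3) C(1) mn(1)])
    moreover have "cblinfun_apply (f z) n = 0"
    proof -
      have "bij_betw (cblinfun_apply (A - (z - \<mu>) *\<^sub>C id_cblinfun)) N N"
        using MN(3) z(2) by (auto simp: quasinilpotent_on_def spectrum_on_def invertible_on_def)
      then obtain u where "u \<in> N" "n = A u - (z - \<mu>) *\<^sub>C u"
        using mn(2) by (auto simp: bij_betw_def shift_apply)
      then show ?thesis using eig[of u] by (simp add: cblinfun_apply_linear scaleC_complex_def)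
    qed
    ultimately show "cblinfun_apply (f z) x = cblinfun_apply 0 x"
      using mn(3) by (simp add: cblinfun_apply_linear zero_cblinfun.rep_eq)
  qed
  show "f z0 = 0"
  proof (rule cblinfun_eqI)
    fix x
    define V where "V = U \<inter> ball \<mu> (1 / C) - {\<mu>}"
    have "cblinfun_apply (f z0) x = 0"
    proof (rule analytic_continuation[where f = "\<lambda>z. cblinfun_apply (f z) x" and S = U and U = V and \<xi> = \<mu>])
      show "(\<lambda>z. cblinfun_apply (f z) x) holomorphic_on U"
        unfolding holomorphic_on_open[OF U(1)]
      proof
        fix z assume "z \<in> U"
        then obtain D where D: "(f has_derivative (\<lambda>h. h *\<^sub>C D)) (at z)"
          using ana by (auto simp: canalytic_on_def)
        have "((\<lambda>z. cblinfun_apply (f z) x) has_derivative (\<lambda>h. cblinfun_apply (h *\<^sub>C D) x)) (at z)"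
          by (rule bounded_linear.has_derivative[OF bounded_linear_evaluation D])
        then have "((\<lambda>z. cblinfun_apply (f z) x) has_field_derivative cblinfun_apply D x) (at z)"
          by (simp add: has_field_derivative_def scaleC_cblinfun.rep_eq scaleC_complex_def mult_commute_abs)
        then show "\<exists>d. ((\<lambda>z. cblinfun_apply (f z) x) has_field_derivative d) (at z)" ..
      qed
      have "\<mu> islimpt (U \<inter> ball \<mu> (1 / C))"
        using U C(1) by (intro interior_limit_point) (simp add: interior_open open_Int)
      then show "\<mu> islimpt V" unfolding V_def using islimpt_punctured by blast
      fix z assume "z \<in> V"
      then show "cblinfun_apply (f z) x = 0"
        using zero[of z] C(1) by (auto simp: V_def dist_norm norm_minus_commute field_simps zero_cblinfun.rep_eq)
    qed (use U z0 in \<open>auto simp: V_def\<close>)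
    then show "cblinfun_apply (f z0) x = cblinfun_apply 0 x" by (simp add: zero_cblinfun.rep_eq)
  qed
qed

section \<open>Equality of the two spectra\<close>

theorem proposition2p4:
  fixes T :: "'a::complex_banach \<Rightarrow>\<^sub>C\<^sub>L 'a"
  shows "sigma_gDQ T = sigma_gDW_minus T \<longleftrightarrow>
    (\<forall>\<mu>. \<mu> \<notin> sigma_gDW_minus T \<longrightarrow> SVEP_at (cadjoint T) \<mu>)"
proof
  assume "sigma_gDQ T = sigma_gDW_minus T"
  then show "\<forall>\<mu>. \<mu> \<notin> sigma_gDW_minus T \<longrightarrow> SVEP_at (cadjoint T) \<mu>"
    using adjoint_SVEP_of_gD_surjective by (auto simp: sigma_gDQ_def)
next
  assume SVEP: "\<forall>\<mu>. \<mu> \<notin> sigma_gDW_minus T \<longrightarrow> SVEP_at (cadjoint T) \<mu>"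
  have "gD_surjective (T - \<mu> *\<^sub>C id_cblinfun)" if "\<mu> \<notin> sigma_gDW_minus T" for \<mu>
    using that SVEP gD_surjective_of_adjoint_SVEP
    unfolding sigma_gDW_minus_def gD_lower_semi_Weyl_def by blast
  moreover have "gD_lower_semi_Weyl (T - \<mu> *\<^sub>C id_cblinfun)" if "gD_surjective (T - \<mu> *\<^sub>C id_cblinfun)" for \<mu>
    using that by (rule gD_surjective_imp_gD_lower_semi_Weyl)
  ultimately show "sigma_gDQ T = sigma_gDW_minus T"
    unfolding sigma_gDQ_def sigma_gDW_minus_def by blast
qed

end
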